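(* Let $\varphi:G\to G$ be an endomorphism of a group $G$. Suppose that TBFT (respectively TBFT$_f$, or TBFT$_{ff}$) takes place for $\varphi$ and its iterations; that is, for $X=\widehat G$ (respectively $X=\widehat G_f$, or $X=\widehat G_{ff}$) and for every $n\in\{1,2,3,\dots\}$ one has $R(\varphi^n)<\infty$ and $R(\varphi^n)$ equals the number of $\widehat\varphi^{\,n}$-f-points in $X$. Then for every $n\ge 1$ $$\sum_{d\mid n}\mu(d)\cdot R(\varphi^{n/d})\equiv 0 \mod n .$$
   Context: For an endomorphism $\psi$ of a (discrete) group $G$, the Reidemeister classes are the equivalence classes of the relation $g\sim xg\psi(x^{-1})$, $x\in G$, and $R(\psi)$ is the number of these classes. The unitary dual $\widehat G$ is the set of (unitary) equivalence classes of irreducible unitary representations of $G$; $\widehat G_f\subset\widehat G$ is the part formed by finite-dimensional representations; $\widehat G_{ff}\subset \widehat G_f$ is the part formed by finite representations, i.e. those that factor through a finite group. A class $[\rho]\in\widehat G$ is called a $\widehat\varphi^{\,n}$-f-point if $\rho$ is equivalent to $\rho\circ\varphi^n$. $\mu$ is the Möbius function: $\mu(1)=1$, $\mu(d)=(-1)^k$ if $d$ is a product of $k$ distinct primes, and $\mu(d)=0$ if $d$ is not square-free. *)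

theory Defs
  imports
    "HOL-Analysis.Analysis"
    "HOL-Algebra.Module"
    "HOL-Computational_Algebra.Squarefree"
    "HOL-Number_Theory.Cong"
begin

section \<open>Complex Hilbert spaces with explicit carrier\<close>

definition complex_ring :: "complex ring" where
  "complex_ring = \<lparr>carrier = UNIV, mult = (*), one = 1, zero = 0, add = (+)\<rparr>"

text \<open>
  The fields \<open>mult\<close> and \<open>one\<close> inherited from the record of rings are unused for modules,
  as always in HOL-Algebra. The inner product is linear in its first argument.
\<close>

record 'v hilbert = "(complex, 'v) module" +
  cinner :: "'v \<Rightarrow> 'v \<Rightarrow> complex"

definition hnorm :: "'v hilbert \<Rightarrow> 'v \<Rightarrow> real" where
  "hnorm H x = sqrt (Re (cinner H x x))"

text \<open>\<^locale>\<open>Metric_space\<close> requires symmetry also outside the carrier, hence the guard.\<close>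

definition hdist :: "'v hilbert \<Rightarrow> 'v \<Rightarrow> 'v \<Rightarrow> real" where
  "hdist H x y =
    (if x \<in> carrier H \<and> y \<in> carrier H then hnorm H (x \<ominus>\<^bsub>H\<^esub> y) else 0)"

locale inner_product_space = module complex_ring H for H :: "'v hilbert" (structure) +
  assumes cinner_add_left:
      "\<lbrakk>x \<in> carrier H; y \<in> carrier H; z \<in> carrier H\<rbrakk> \<Longrightarrow>
        cinner H (x \<oplus> y) z = cinner H x z + cinner H y z"
    and cinner_smult_left:
      "\<lbrakk>x \<in> carrier H; y \<in> carrier H\<rbrakk> \<Longrightarrow> cinner H (a \<odot> x) y = a * cinner H x y"
    and cinner_commute:
      "\<lbrakk>x \<in> carrier H; y \<in> carrier H\<rbrakk> \<Longrightarrow> cinner H y x = cnj (cinner H x y)"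
    and cinner_pos:
      "\<lbrakk>x \<in> carrier H; x \<noteq> \<zero>\<rbrakk> \<Longrightarrow> Re (cinner H x x) > 0"

locale hilbert_space = inner_product_space +
  assumes complete: "Metric_space.mcomplete (carrier H) (hdist H)"

definition finite_dimensional :: "'v hilbert \<Rightarrow> bool" where
  "finite_dimensional H \<longleftrightarrow>
    (\<exists>B. finite B \<and> B \<subseteq> carrier H \<and>
      (\<forall>x \<in> carrier H. \<exists>a. x = (\<Oplus>\<^bsub>H\<^esub>b\<in>B. a b \<odot>\<^bsub>H\<^esub> b)))"

definition unitary_maps ::
    "'v hilbert \<Rightarrow> 'w hilbert \<Rightarrow> ('v \<Rightarrow> 'w) set" where
  "unitary_maps H K = {U. bij_betw U (carrier H) (carrier K) \<and>
    (\<forall>x \<in> carrier H. \<forall>y \<in> carrier H. U (x \<oplus>\<^bsub>H\<^esub> y) = U x \<oplus>\<^bsub>K\<^esub> U y) \<and>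
    (\<forall>a. \<forall>x \<in> carrier H. U (a \<odot>\<^bsub>H\<^esub> x) = a \<odot>\<^bsub>K\<^esub> U x) \<and>
    (\<forall>x \<in> carrier H. \<forall>y \<in> carrier H. cinner K (U x) (U y) = cinner H x y)}"


section \<open>Unitary representations of discrete groups\<close>

text \<open>A representation is a Hilbert space together with an action of the group on it.\<close>

type_synonym ('g, 'v) rep = "'v hilbert \<times> ('g \<Rightarrow> 'v \<Rightarrow> 'v)"

definition unitary_rep :: "('g, 'm) monoid_scheme \<Rightarrow> ('g, 'v) rep \<Rightarrow> bool" where
  "unitary_rep G = (\<lambda>(H, \<rho>). hilbert_space H \<and>
    (\<forall>g \<in> carrier G. \<rho> g \<in> unitary_maps H H) \<and>
    (\<forall>v \<in> carrier H. \<rho> \<one>\<^bsub>G\<^esub> v = v) \<and>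
    (\<forall>g \<in> carrier G. \<forall>h \<in> carrier G. \<forall>v \<in> carrier H. \<rho> (g \<otimes>\<^bsub>G\<^esub> h) v = \<rho> g (\<rho> h v)))"

definition irreducible_rep :: "('g, 'm) monoid_scheme \<Rightarrow> ('g, 'v) rep \<Rightarrow> bool" where
  "irreducible_rep G = (\<lambda>(H, \<rho>). carrier H \<noteq> {\<zero>\<^bsub>H\<^esub>} \<and>
    (\<forall>W. submodule W complex_ring H \<and>
         closedin (Metric_space.mtopology (carrier H) (hdist H)) W \<and>
         (\<forall>g \<in> carrier G. \<rho> g ` W \<subseteq> W) \<longrightarrow>
       W = {\<zero>\<^bsub>H\<^esub>} \<or> W = carrier H))"

definition irreps :: "('g, 'm) monoid_scheme \<Rightarrow> ('g, 'v) rep set" where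
  "irreps G = {\<pi>. unitary_rep G \<pi> \<and> irreducible_rep G \<pi>}"

definition rep_equivalent ::
    "('g, 'm) monoid_scheme \<Rightarrow> ('g, 'v) rep \<Rightarrow> ('g, 'w) rep \<Rightarrow> bool" where
  "rep_equivalent G = (\<lambda>(H, \<rho>) (K, \<sigma>). \<exists>U \<in> unitary_maps H K.
    \<forall>g \<in> carrier G. \<forall>v \<in> carrier H. U (\<rho> g v) = \<sigma> g (U v))"

definition rep_comp :: "('h, 'v) rep \<Rightarrow> ('g \<Rightarrow> 'h) \<Rightarrow> ('g, 'v) rep" where
  "rep_comp \<pi> f = (fst \<pi>, \<lambda>g. snd \<pi> (f g))"

definition finite_dimensional_rep :: "('g, 'v) rep \<Rightarrow> bool" where
  "finite_dimensional_rep \<pi> \<longleftrightarrow> finite_dimensional (fst \<pi>)"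

text \<open>
  Every finite group is isomorphic to one whose elements are natural numbers, so that
  the restriction to the type \<^typ>\<open>nat\<close> is harmless.
\<close>

definition finite_rep :: "('g, 'm) monoid_scheme \<Rightarrow> ('g, 'v) rep \<Rightarrow> bool" where
  "finite_rep G \<pi> \<longleftrightarrow>
    (\<exists>(F :: nat monoid) f \<tau>. group F \<and> finite (carrier F) \<and> f \<in> hom G F \<and>
      unitary_rep F (fst \<pi>, \<tau>) \<and>
      (\<forall>g \<in> carrier G. \<forall>v \<in> carrier (fst \<pi>). snd \<pi> g v = \<tau> (f g) v))"


section \<open>The unitary dual\<close>

text \<open>
  The Hilbert spaces of all irreducible unitary representations do not live in one type.
  But an irreducible representation on \<open>H\<close> embeds linearly into the functions on the group
  by matrix coefficients, \<open>w \<mapsto> (g \<mapsto> \<langle>w, \<rho>(g) v\<rangle>)\<close> with \<open>v \<noteq> 0\<close> fixed, so that up to equivalence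
  it suffices to consider Hilbert spaces whose carrier is a set of functions
  \<open>'g \<Rightarrow> complex\<close> (with arbitrary Hilbert space operations). This is proved below in
  \<open>irrep_equivalent_coefficient_irrep\<close>.
\<close>

definition irrep_relation ::
    "('g, 'm) monoid_scheme \<Rightarrow> (('g, 'v) rep \<times> ('g, 'v) rep) set" where
  "irrep_relation G = {(\<pi>, \<sigma>). \<pi> \<in> irreps G \<and> \<sigma> \<in> irreps G \<and> rep_equivalent G \<pi> \<sigma>}"

definition unitary_dual ::
    "('g, 'm) monoid_scheme \<Rightarrow> ('g, 'g \<Rightarrow> complex) rep set set" where
  "unitary_dual G = irreps G // irrep_relation G"

definition unitary_dual_f ::
    "('g, 'm) monoid_scheme \<Rightarrow> ('g, 'g \<Rightarrow> complex) rep set set" where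
  "unitary_dual_f G = {c \<in> unitary_dual G. \<exists>\<pi> \<in> c. finite_dimensional_rep \<pi>}"

definition unitary_dual_ff ::
    "('g, 'm) monoid_scheme \<Rightarrow> ('g, 'g \<Rightarrow> complex) rep set set" where
  "unitary_dual_ff G = {c \<in> unitary_dual_f G. \<exists>\<pi> \<in> c. finite_rep G \<pi>}"

definition f_points ::
    "('g, 'm) monoid_scheme \<Rightarrow> ('g, 'v) rep set set \<Rightarrow> ('g \<Rightarrow> 'g) \<Rightarrow> ('g, 'v) rep set set" where
  "f_points G X \<psi> = {c \<in> X. \<exists>\<pi> \<in> c. rep_equivalent G \<pi> (rep_comp \<pi> \<psi>)}"


section \<open>Reidemeister numbers\<close>

definition reidemeister_relation ::
    "('g, 'm) monoid_scheme \<Rightarrow> ('g \<Rightarrow> 'g) \<Rightarrow> ('g \<times> 'g) set" where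
  "reidemeister_relation G \<psi> = {(g, h). g \<in> carrier G \<and> h \<in> carrier G \<and>
    (\<exists>x \<in> carrier G. h = x \<otimes>\<^bsub>G\<^esub> g \<otimes>\<^bsub>G\<^esub> \<psi> (inv\<^bsub>G\<^esub> x))}"

definition reidemeister_classes ::
    "('g, 'm) monoid_scheme \<Rightarrow> ('g \<Rightarrow> 'g) \<Rightarrow> 'g set set" where
  "reidemeister_classes G \<psi> = carrier G // reidemeister_relation G \<psi>"

definition reidemeister_number :: "('g, 'm) monoid_scheme \<Rightarrow> ('g \<Rightarrow> 'g) \<Rightarrow> nat" where
  "reidemeister_number G \<psi> = card (reidemeister_classes G \<psi>)"

text \<open>
  Twisted Burnside--Frobenius property for the endomorphism \<open>\<psi>\<close> and the part \<open>X\<close> of the dual.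
  Finiteness is explicit because \<open>card\<close> is \<open>0\<close> on infinite sets.
\<close>

definition tbft ::
    "('g, 'm) monoid_scheme \<Rightarrow> ('g, 'v) rep set set \<Rightarrow> ('g \<Rightarrow> 'g) \<Rightarrow> bool" where
  "tbft G X \<psi> \<longleftrightarrow> finite (reidemeister_classes G \<psi>) \<and> finite (f_points G X \<psi>) \<and>
    reidemeister_number G \<psi> = card (f_points G X \<psi>)"

definition moebius_mu :: "nat \<Rightarrow> int" where
  "moebius_mu n = (if squarefree n then (- 1) ^ card (prime_factors n) else 0)"


section \<open>Well-definedness of the unitary dual\<close>

lemma complex_ring_simps [simp]:
  "carrier complex_ring = UNIV" "add complex_ring = (+)" "mult complex_ring = (*)"
  "one complex_ring = 1" "zero complex_ring = 0"
  by (simp_all add: complex_ring_def)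

context inner_product_space
begin

lemma minus_smult: assumes "x \<in> carrier H" "y \<in> carrier H" shows "x \<ominus> y = x \<oplus> (-1) \<odot> y"
proof -
  have "y \<oplus> (-1) \<odot> y = (1 + (-1)) \<odot> y"
    using smult_l_distr[of 1 "-1" y] smult_one[of y] assms by simp
  also have "\<dots> = \<zero>" using smult_l_null[of y] assms by simp
  finally have "\<ominus> y = (-1) \<odot> y"
    using assms smult_closed[of "-1" y] M.minus_equality[of "(-1) \<odot> y" y] M.a_comm by simp
  then show ?thesis by (simp add: a_minus_def)
qed

lemma right_minus_eq:
  assumes "x \<in> carrier H" "y \<in> carrier H" shows "x \<ominus> y = \<zero> \<longleftrightarrow> x = y"
  using assms M.minus_equality[of x "\<ominus> y"] by (auto simp: a_minus_def M.r_neg)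

lemma smult_in [simp]: "x \<in> carrier H \<Longrightarrow> a \<odot> x \<in> carrier H"
  using smult_closed by simp

lemma cinner_add_right:
  "\<lbrakk>x \<in> carrier H; y \<in> carrier H; z \<in> carrier H\<rbrakk> \<Longrightarrow>
     cinner H z (x \<oplus> y) = cinner H z x + cinner H z y"
  by (metis M.add.m_closed cinner_add_left cinner_commute complex_cnj_add)

lemma cinner_smult_right:
  "\<lbrakk>x \<in> carrier H; y \<in> carrier H\<rbrakk> \<Longrightarrow> cinner H y (a \<odot> x) = cnj a * cinner H y x"
  by (metis smult_in cinner_smult_left cinner_commute complex_cnj_mult)

lemma cinner_zero_left [simp]: "y \<in> carrier H \<Longrightarrow> cinner H \<zero> y = 0"
  using cinner_add_left[of \<zero> \<zero> y] by simp

lemma cinner_minus_left: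
  "\<lbrakk>x \<in> carrier H; y \<in> carrier H; z \<in> carrier H\<rbrakk> \<Longrightarrow>
     cinner H (x \<ominus> y) z = cinner H x z - cinner H y z"
  by (simp add: minus_smult cinner_add_left cinner_smult_left)

lemma cinner_self: "x \<in> carrier H \<Longrightarrow> cinner H x x = complex_of_real ((hnorm H x)\<^sup>2)"
proof -
  assume x: "x \<in> carrier H"
  have "Im (cinner H x x) = 0" using cinner_commute[OF x x] by (simp add: complex_eq_iff)
  moreover have "Re (cinner H x x) \<ge> 0"
    using x cinner_pos[OF x] by (cases "x = \<zero>") auto
  ultimately show ?thesis by (simp add: hnorm_def complex_eq_iff)
qed

lemma hnorm_nonneg [simp]: "x \<in> carrier H \<Longrightarrow> hnorm H x \<ge> 0"
  using cinner_pos[of x] by (cases "x = \<zero>") (auto simp: hnorm_def)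

lemma hnorm_eq_0: "x \<in> carrier H \<Longrightarrow> hnorm H x = 0 \<longleftrightarrow> x = \<zero>"
  using cinner_pos[of x] by (cases "x = \<zero>") (auto simp: hnorm_def)

lemma cauchy_schwarz:
  assumes x: "x \<in> carrier H" and y: "y \<in> carrier H"
  shows "cmod (cinner H x y) \<le> hnorm H x * hnorm H y"
proof (cases "y = \<zero>")
  case True
  then have "cinner H x y = 0" using cinner_commute[OF y x] x by simp
  then show ?thesis using x y by (simp only: norm_zero) (intro mult_nonneg_nonneg hnorm_nonneg)
next
  case False
  define n where "n = (hnorm H y)\<^sup>2"
  define c where "c = cinner H x y"
  have npos: "n > 0" using hnorm_eq_0[OF y] False by (simp add: n_def)
  have yy: "cinner H y y = of_real n" using cinner_self[OF y] n_def by simp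
  have yx: "cinner H y x = cnj c" unfolding c_def using x y by (rule cinner_commute)
  define a where "a = - c / of_real n"
  define z where "z = x \<oplus> a \<odot> y"
  have z: "z \<in> carrier H" using x y by (simp add: z_def)
  have xz: "cinner H x z = cinner H x x + cnj a * c"
    using x y by (simp only: z_def cinner_add_right cinner_smult_right smult_in c_def)
  have yz: "cinner H y z = cnj c + cnj a * of_real n"
    using x y by (simp only: z_def cinner_add_right cinner_smult_right smult_in yx yy)
  have "cinner H z z = cinner H x z + a * cinner H y z"
    using x y z unfolding z_def by (simp only: cinner_add_left cinner_smult_left smult_in)
  also have "\<dots> = cinner H x x + (cnj a * c + a * cnj c + a * cnj a * of_real n)"
    unfolding xz yz by (simp only: distrib_left mult.assoc add.assoc)
  also have "cnj a * c + a * cnj c + a * cnj a * of_real n = - (c * cnj c / of_real n)"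
  proof -
    have "cnj a * c = - (c * cnj c / of_real n)" "a * cnj c = - (c * cnj c / of_real n)"
      "a * cnj a * of_real n = c * cnj c / of_real n"
      using npos by (simp_all add: a_def)
    then show ?thesis by simp
  qed
  also have "cinner H x x + - (c * cnj c / of_real n) =
      of_real ((hnorm H x)\<^sup>2 - (cmod c)\<^sup>2 / n)"
    unfolding cinner_self[OF x] complex_norm_square[of c, symmetric] by simp
  finally have "of_real ((hnorm H z)\<^sup>2) = complex_of_real ((hnorm H x)\<^sup>2 - (cmod c)\<^sup>2 / n)"
    unfolding cinner_self[OF z] .
  then have "(hnorm H z)\<^sup>2 = (hnorm H x)\<^sup>2 - (cmod c)\<^sup>2 / n"
    using of_real_eq_iff by blast
  then have "(cmod c)\<^sup>2 / n \<le> (hnorm H x)\<^sup>2"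
    using zero_le_power2[of "hnorm H z"] by linarith
  then have "(cmod c)\<^sup>2 \<le> (hnorm H x * hnorm H y)\<^sup>2"
    using npos by (simp add: pos_divide_le_eq n_def power_mult_distrib)
  then show ?thesis unfolding c_def using x y
    by (meson hnorm_nonneg mult_nonneg_nonneg power2_le_imp_le)
qed

lemma hnorm_add:
  assumes x: "x \<in> carrier H" and y: "y \<in> carrier H"
  shows "hnorm H (x \<oplus> y) \<le> hnorm H x + hnorm H y"
proof -
  have xy: "x \<oplus> y \<in> carrier H" using x y by simp
  have "(hnorm H (x \<oplus> y))\<^sup>2 = Re (cinner H (x \<oplus> y) (x \<oplus> y))"
    using cinner_self[OF xy] by simp
  also have "\<dots> = (hnorm H x)\<^sup>2 + 2 * Re (cinner H x y) + (hnorm H y)\<^sup>2"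
    using x y cinner_commute[OF x y] cinner_self[OF x] cinner_self[OF y]
    by (simp add: cinner_add_left cinner_add_right)
  also have "\<dots> \<le> (hnorm H x)\<^sup>2 + 2 * (hnorm H x * hnorm H y) + (hnorm H y)\<^sup>2"
    using cauchy_schwarz[OF x y] complex_Re_le_cmod[of "cinner H x y"] by linarith
  also have "\<dots> = (hnorm H x + hnorm H y)\<^sup>2" by (simp add: power2_sum)
  finally show ?thesis using x y by (meson add_nonneg_nonneg hnorm_nonneg power2_le_imp_le)
qed

lemma hnorm_smult: "x \<in> carrier H \<Longrightarrow> hnorm H (a \<odot> x) = cmod a * hnorm H x"
proof -
  assume x: "x \<in> carrier H"
  have "complex_of_real ((hnorm H (a \<odot> x))\<^sup>2) = of_real ((cmod a * hnorm H x)\<^sup>2)"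
    using x cinner_self[of "a \<odot> x"] cinner_self[OF x] complex_norm_square[of a]
    by (simp add: cinner_smult_left cinner_smult_right power_mult_distrib mult_ac)
  then have "(hnorm H (a \<odot> x))\<^sup>2 = (cmod a * hnorm H x)\<^sup>2" using of_real_eq_iff by blast
  then show ?thesis using x by (simp add: power2_eq_iff_nonneg)
qed


lemma metric_space: "Metric_space (carrier H) (hdist H)"
proof
  show "0 \<le> hdist H x y" for x y by (simp add: hdist_def)
  show "hdist H x y = hdist H y x" for x y
  proof (cases "x \<in> carrier H \<and> y \<in> carrier H")
    case True
    then have x: "x \<in> carrier H" and y: "y \<in> carrier H" by auto
    have "(-1) \<odot> (x \<ominus> y) = (-1) \<odot> x \<oplus> (-1) \<odot> ((-1) \<odot> y)"
      using smult_r_distr[of "-1" x "(-1) \<odot> y"] x y by (simp add: minus_smult)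
    also have "(-1) \<odot> ((-1) \<odot> y) = y"
      using smult_assoc1[of "-1" "-1" y] smult_one[of y] y by simp
    also have "(-1) \<odot> x \<oplus> y = y \<ominus> x" using x y by (simp only: minus_smult M.a_comm smult_in)
    finally have "hnorm H (y \<ominus> x) = hnorm H (x \<ominus> y)"
      using hnorm_smult[of "x \<ominus> y" "-1"] x y by simp
    then show ?thesis using x y by (simp only: hdist_def if_True simp_thms)
  next
    case False
    then show ?thesis unfolding hdist_def by presburger
  qed
  show "hdist H x y = 0 \<longleftrightarrow> x = y" if "x \<in> carrier H" "y \<in> carrier H" for x y
    using that hnorm_eq_0[of "x \<ominus> y"] by (simp add: hdist_def right_minus_eq)
  show "hdist H x z \<le> hdist H x y + hdist H y z"
    if "x \<in> carrier H" "y \<in> carrier H" "z \<in> carrier H" for x y z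
  proof -
    have "x \<ominus> z = (x \<ominus> y) \<oplus> (y \<ominus> z)"
    proof -
      have "(x \<ominus> y) \<oplus> (y \<ominus> z) = x \<oplus> (\<ominus> y \<oplus> (y \<oplus> \<ominus> z))"
        using that by (simp only: a_minus_def M.a_assoc M.a_inv_closed M.a_closed)
      then show ?thesis using that by (simp only: M.r_neg1 M.a_inv_closed a_minus_def)
    qed
    then show ?thesis using that hnorm_add[of "x \<ominus> y" "y \<ominus> z"] by (simp add: hdist_def)
  qed
qed

end

lemma unitary_mapsD:
  assumes "U \<in> unitary_maps H K"
  shows "bij_betw U (carrier H) (carrier K)"
    and "x \<in> carrier H \<Longrightarrow> U x \<in> carrier K"
    and "\<lbrakk>x \<in> carrier H; y \<in> carrier H\<rbrakk> \<Longrightarrow> U (x \<oplus>\<^bsub>H\<^esub> y) = U x \<oplus>\<^bsub>K\<^esub> U y"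
    and "x \<in> carrier H \<Longrightarrow> U (a \<odot>\<^bsub>H\<^esub> x) = a \<odot>\<^bsub>K\<^esub> U x"
    and "\<lbrakk>x \<in> carrier H; y \<in> carrier H\<rbrakk> \<Longrightarrow> cinner K (U x) (U y) = cinner H x y"
    and "\<lbrakk>x \<in> carrier H; y \<in> carrier H; U x = U y\<rbrakk> \<Longrightarrow> x = y"
    and "z \<in> carrier K \<Longrightarrow> \<exists>x \<in> carrier H. z = U x"
proof -
  have bij: "bij_betw U (carrier H) (carrier K)" using assms by (simp add: unitary_maps_def)
  then show "bij_betw U (carrier H) (carrier K)" .
  show "x \<in> carrier H \<Longrightarrow> U x \<in> carrier K" using bij by (rule bij_betwE[rule_format])
  show "\<lbrakk>x \<in> carrier H; y \<in> carrier H\<rbrakk> \<Longrightarrow> U (x \<oplus>\<^bsub>H\<^esub> y) = U x \<oplus>\<^bsub>K\<^esub> U y"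
    "x \<in> carrier H \<Longrightarrow> U (a \<odot>\<^bsub>H\<^esub> x) = a \<odot>\<^bsub>K\<^esub> U x"
    "\<lbrakk>x \<in> carrier H; y \<in> carrier H\<rbrakk> \<Longrightarrow> cinner K (U x) (U y) = cinner H x y"
    using assms unfolding unitary_maps_def by blast+
  show "\<lbrakk>x \<in> carrier H; y \<in> carrier H; U x = U y\<rbrakk> \<Longrightarrow> x = y"
    using bij unfolding bij_betw_def inj_on_def by blast
  show "z \<in> carrier K \<Longrightarrow> \<exists>x \<in> carrier H. z = U x"
    using bij unfolding bij_betw_def by blast
qed

lemma unitary_maps_inv:
  assumes "U \<in> unitary_maps H K" and H: "inner_product_space H"
  shows "inv_into (carrier H) U \<in> unitary_maps K H"
proof -
  interpret H: inner_product_space H by (fact H)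
  note U = unitary_mapsD[OF assms(1)]
  let ?V = "inv_into (carrier H) U"
  have inj: "inj_on U (carrier H)" using U(1) by (simp add: bij_betw_def)
  have V: "?V (U x) = x" if "x \<in> carrier H" for x using that inj by simp
  show ?thesis
    unfolding unitary_maps_def
  proof (intro CollectI conjI ballI allI)
    show "bij_betw ?V (carrier K) (carrier H)" using U(1) by (rule bij_betw_inv_into)
  next
    fix x y assume "x \<in> carrier K" "y \<in> carrier K"
    then obtain x' y' where "x' \<in> carrier H" "x = U x'" "y' \<in> carrier H" "y = U y'"
      using U(7)[of x] U(7)[of y] by auto
    then show "?V (x \<oplus>\<^bsub>K\<^esub> y) = ?V x \<oplus>\<^bsub>H\<^esub> ?V y" "cinner H (?V x) (?V y) = cinner K x y"
      by (simp_all add: V U(3)[symmetric] U(5))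
  next
    fix a x assume "x \<in> carrier K"
    then obtain x' where "x' \<in> carrier H" "x = U x'" using U(7)[of x] by auto
    then show "?V (a \<odot>\<^bsub>K\<^esub> x) = a \<odot>\<^bsub>H\<^esub> ?V x" by (simp add: V U(4)[symmetric])
  qed
qed

lemma unitary_maps_comp:
  assumes "U \<in> unitary_maps H K" "V \<in> unitary_maps K L"
  shows "V \<circ> U \<in> unitary_maps H L"
proof -
  note U = unitary_mapsD[OF assms(1)] and V = unitary_mapsD[OF assms(2)]
  show ?thesis unfolding unitary_maps_def
    by (intro CollectI conjI ballI allI bij_betw_trans[OF U(1) V(1)])
      (simp_all add: U(2-5) V(3-5))
qed

lemma hilbert_inner: "hilbert_space H \<Longrightarrow> inner_product_space H"
  by (simp add: hilbert_space_def)

lemma rep_equivalent_refl: "rep_equivalent G \<pi> \<pi>"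
proof -
  have "id \<in> unitary_maps (fst \<pi>) (fst \<pi>)" by (simp add: unitary_maps_def)
  then show ?thesis by (cases \<pi>) (auto simp: rep_equivalent_def intro!: bexI[of _ id])
qed

lemma rep_equivalent_sym:
  assumes eq: "rep_equivalent G \<pi> \<sigma>" and \<pi>: "unitary_rep G \<pi>"
  shows "rep_equivalent G \<sigma> \<pi>"
proof -
  obtain H \<rho> K \<tau> where p: "\<pi> = (H, \<rho>)" "\<sigma> = (K, \<tau>)" by (cases \<pi>, cases \<sigma>)
  from eq obtain U where U: "U \<in> unitary_maps H K"
    and i: "\<And>g v. \<lbrakk>g \<in> carrier G; v \<in> carrier H\<rbrakk> \<Longrightarrow> U (\<rho> g v) = \<tau> g (U v)"
    unfolding rep_equivalent_def p split_conv by blast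
  have H: "inner_product_space H" and \<rho>: "\<And>g. g \<in> carrier G \<Longrightarrow> \<rho> g \<in> unitary_maps H H"
    using \<pi> by (auto simp: unitary_rep_def p hilbert_inner)
  let ?V = "inv_into (carrier H) U"
  have inj: "inj_on U (carrier H)" using unitary_mapsD(1)[OF U] by (simp add: bij_betw_def)
  have "?V (\<tau> g w) = \<rho> g (?V w)" if g: "g \<in> carrier G" and w: "w \<in> carrier K" for g w
  proof -
    obtain v where v: "v \<in> carrier H" "w = U v" using unitary_mapsD(7)[OF U w] by auto
    then have "\<rho> g v \<in> carrier H" using unitary_mapsD(2)[OF \<rho>[OF g]] by simp
    then show ?thesis using v inj by (simp add: i[OF g, symmetric])
  qed
  then show ?thesis unfolding rep_equivalent_def p split_conv
    by (intro bexI[OF _ unitary_maps_inv[OF U H]]) blast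
qed

lemma rep_equivalent_trans:
  assumes "rep_equivalent G \<pi> \<sigma>" "rep_equivalent G \<sigma> \<tau>"
  shows "rep_equivalent G \<pi> \<tau>"
proof -
  obtain H \<rho> K \<sigma>' L \<tau>' where p: "\<pi> = (H, \<rho>)" "\<sigma> = (K, \<sigma>')" "\<tau> = (L, \<tau>')"
    by (cases \<pi>, cases \<sigma>, cases \<tau>)
  from assms obtain U V where UV: "U \<in> unitary_maps H K" "V \<in> unitary_maps K L"
    and i: "\<And>g v. \<lbrakk>g \<in> carrier G; v \<in> carrier H\<rbrakk> \<Longrightarrow> U (\<rho> g v) = \<sigma>' g (U v)"
      "\<And>g v. \<lbrakk>g \<in> carrier G; v \<in> carrier K\<rbrakk> \<Longrightarrow> V (\<sigma>' g v) = \<tau>' g (V v)"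
    unfolding rep_equivalent_def p split_conv by blast
  have "(V \<circ> U) (\<rho> g v) = \<tau>' g ((V \<circ> U) v)" if "g \<in> carrier G" "v \<in> carrier H" for g v
    using that i unitary_mapsD(2)[OF UV(1)] by simp
  then show ?thesis unfolding rep_equivalent_def p split_conv
    by (intro bexI[OF _ unitary_maps_comp[OF UV]]) blast
qed

lemma rep_equivalent_comp:
  assumes eq: "rep_equivalent G \<pi> \<sigma>" and f: "f \<in> carrier F \<rightarrow> carrier G"
  shows "rep_equivalent F (rep_comp \<pi> f) (rep_comp \<sigma> f)"
proof -
  obtain H \<rho> K \<tau> where p: "\<pi> = (H, \<rho>)" "\<sigma> = (K, \<tau>)" by (cases \<pi>, cases \<sigma>)
  from eq obtain U where U: "U \<in> unitary_maps H K"
    and i: "\<And>g v. \<lbrakk>g \<in> carrier G; v \<in> carrier H\<rbrakk> \<Longrightarrow> U (\<rho> g v) = \<tau> g (U v)"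
    unfolding rep_equivalent_def p split_conv by blast
  then show ?thesis
    using f unfolding rep_equivalent_def rep_comp_def p split_conv fst_conv snd_conv
    by (intro bexI[OF _ U]) blast
qed

text \<open>Being an f-point does not depend on the representative.\<close>

lemma f_point_independent:
  assumes "rep_equivalent G \<pi> \<sigma>" "unitary_rep G \<pi>" "\<psi> \<in> hom G G"
    and "rep_equivalent G \<pi> (rep_comp \<pi> \<psi>)"
  shows "rep_equivalent G \<sigma> (rep_comp \<sigma> \<psi>)"
proof -
  have "rep_equivalent G (rep_comp \<pi> \<psi>) (rep_comp \<sigma> \<psi>)"
    using assms(1,3) by (intro rep_equivalent_comp) (auto simp: hom_def)
  then show ?thesis
    using rep_equivalent_trans[OF rep_equivalent_sym[OF assms(1,2)]]
      rep_equivalent_trans[OF assms(4)] by blast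
qed

lemma equiv_irrep_relation: "equiv (irreps G) (irrep_relation G)"
proof (rule equivI)
  show "refl_on (irreps G) (irrep_relation G)"
    by (auto simp: refl_on_def irrep_relation_def rep_equivalent_refl)
  show "sym (irrep_relation G)"
    by (auto simp: sym_def irrep_relation_def irreps_def intro: rep_equivalent_sym)
  show "trans (irrep_relation G)"
    by (auto simp: trans_def irrep_relation_def intro: rep_equivalent_trans)
qed (auto simp: irrep_relation_def)

lemma inner_product_space_transport:
  assumes H: "inner_product_space H" and Um: "U \<in> unitary_maps H K"
    and zero: "\<zero>\<^bsub>K\<^esub> = U \<zero>\<^bsub>H\<^esub>"
  shows "inner_product_space K"
proof -
  interpret H: inner_product_space H by (fact H)
  note U = unitary_mapsD[OF Um]
  have ex: "P y" if "y \<in> carrier K" "\<And>x. x \<in> carrier H \<Longrightarrow> P (U x)" for P y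
    using U(7) that by metis
  have grp: "abelian_group K"
  proof (rule abelian_groupI)
    show "x \<oplus>\<^bsub>K\<^esub> y \<in> carrier K" if x: "x \<in> carrier K" and y: "y \<in> carrier K" for x y
      by (rule ex[OF x], rule ex[OF y]) (simp add: U(3)[symmetric] U(2))
    show "\<zero>\<^bsub>K\<^esub> \<in> carrier K" by (simp add: zero U(2))
    show "x \<oplus>\<^bsub>K\<^esub> y \<oplus>\<^bsub>K\<^esub> z = x \<oplus>\<^bsub>K\<^esub> (y \<oplus>\<^bsub>K\<^esub> z)"
      if x: "x \<in> carrier K" and y: "y \<in> carrier K" and z: "z \<in> carrier K" for x y z
      by (rule ex[OF x], rule ex[OF y], rule ex[OF z]) (simp add: U(3)[symmetric] H.M.a_assoc)
    show "x \<oplus>\<^bsub>K\<^esub> y = y \<oplus>\<^bsub>K\<^esub> x" if x: "x \<in> carrier K" and y: "y \<in> carrier K" for x y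
      by (rule ex[OF x], rule ex[OF y]) (simp add: U(3)[symmetric] H.M.a_comm)
    show "\<zero>\<^bsub>K\<^esub> \<oplus>\<^bsub>K\<^esub> x = x" if x: "x \<in> carrier K" for x
      by (rule ex[OF x]) (simp add: zero U(3)[symmetric])
    show "\<exists>y \<in> carrier K. y \<oplus>\<^bsub>K\<^esub> x = \<zero>\<^bsub>K\<^esub>" if x: "x \<in> carrier K" for x
    proof (rule ex[OF x])
      fix x assume x: "x \<in> carrier H"
      then have "U (\<ominus>\<^bsub>H\<^esub> x) \<oplus>\<^bsub>K\<^esub> U x = \<zero>\<^bsub>K\<^esub>" by (simp add: zero U(3)[symmetric] H.M.l_neg)
      then show "\<exists>y \<in> carrier K. y \<oplus>\<^bsub>K\<^esub> U x = \<zero>\<^bsub>K\<^esub>" using x U(2) by (meson H.M.a_inv_closed)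
    qed
  qed
  have mod: "module complex_ring K"
  proof (rule moduleI)
    show "cring complex_ring" by (rule H.R.is_cring)
    show "a \<odot>\<^bsub>K\<^esub> x \<in> carrier K" if x: "x \<in> carrier K" for a x
      by (rule ex[OF x]) (simp add: U(4)[symmetric] U(2))
    show "(a \<oplus>\<^bsub>complex_ring\<^esub> b) \<odot>\<^bsub>K\<^esub> x = a \<odot>\<^bsub>K\<^esub> x \<oplus>\<^bsub>K\<^esub> b \<odot>\<^bsub>K\<^esub> x" if x: "x \<in> carrier K" for a b x
      by (rule ex[OF x]) (use H.smult_l_distr in \<open>simp add: U(3,4)[symmetric]\<close>)
    show "a \<odot>\<^bsub>K\<^esub> (x \<oplus>\<^bsub>K\<^esub> y) = a \<odot>\<^bsub>K\<^esub> x \<oplus>\<^bsub>K\<^esub> a \<odot>\<^bsub>K\<^esub> y"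
      if x: "x \<in> carrier K" and y: "y \<in> carrier K" for a x y
      by (rule ex[OF x], rule ex[OF y]) (use H.smult_r_distr in \<open>simp add: U(3,4)[symmetric]\<close>)
    show "(a \<otimes>\<^bsub>complex_ring\<^esub> b) \<odot>\<^bsub>K\<^esub> x = a \<odot>\<^bsub>K\<^esub> (b \<odot>\<^bsub>K\<^esub> x)" if x: "x \<in> carrier K" for a b x
      by (rule ex[OF x]) (use H.smult_assoc1 in \<open>simp add: U(4)[symmetric]\<close>)
    show "\<one>\<^bsub>complex_ring\<^esub> \<odot>\<^bsub>K\<^esub> x = x" if x: "x \<in> carrier K" for x
      by (rule ex[OF x]) (use H.smult_one in \<open>simp add: U(4)[symmetric]\<close>)
  qed (fact grp)
  show ?thesis
  proof (intro inner_product_space.intro mod inner_product_space_axioms.intro)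
    show "cinner K (x \<oplus>\<^bsub>K\<^esub> y) z = cinner K x z + cinner K y z"
      if x: "x \<in> carrier K" and y: "y \<in> carrier K" and z: "z \<in> carrier K" for x y z
      by (rule ex[OF x], rule ex[OF y], rule ex[OF z])
        (simp add: U(3)[symmetric] U(5) H.cinner_add_left)
    show "cinner K (a \<odot>\<^bsub>K\<^esub> x) y = a * cinner K x y"
      if x: "x \<in> carrier K" and y: "y \<in> carrier K" for a x y
      by (rule ex[OF x], rule ex[OF y]) (simp add: U(4)[symmetric] U(5) H.cinner_smult_left)
    show "cinner K y x = cnj (cinner K x y)"
      if x: "x \<in> carrier K" and y: "y \<in> carrier K" for x y
      by (rule ex[OF x], rule ex[OF y]) (simp only: U(5), rule H.cinner_commute)
    show "Re (cinner K x x) > 0" if x: "x \<in> carrier K" and nz: "x \<noteq> \<zero>\<^bsub>K\<^esub>" for x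
    proof -
      obtain x' where "x' \<in> carrier H" "x = U x'" using U(7)[OF x] by auto
      then show ?thesis using nz H.cinner_pos[of x'] by (auto simp: U(5) zero)
    qed
  qed
qed

lemma hdist_unitary:
  assumes "inner_product_space H" "inner_product_space K" and Um: "U \<in> unitary_maps H K"
    and x: "x \<in> carrier H" and y: "y \<in> carrier H"
  shows "hdist K (U x) (U y) = hdist H x y"
proof -
  interpret H: inner_product_space H by fact
  interpret K: inner_product_space K by fact
  note U = unitary_mapsD[OF Um]
  have "U x \<ominus>\<^bsub>K\<^esub> U y = U (x \<ominus>\<^bsub>H\<^esub> y)"
    using x y by (simp add: H.minus_smult K.minus_smult U(2,3,4))
  then show ?thesis using x y by (simp add: hdist_def hnorm_def U(2,5))
qed

lemma hilbert_space_transport: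
  assumes Hs: "hilbert_space H" and Um: "U \<in> unitary_maps H K"
    and zero: "\<zero>\<^bsub>K\<^esub> = U \<zero>\<^bsub>H\<^esub>"
  shows "hilbert_space K"
proof -
  interpret H: hilbert_space H by (fact Hs)
  interpret K: inner_product_space K
    using inner_product_space_transport H.inner_product_space_axioms Um zero by blast
  interpret MH: Metric_space "carrier H" "hdist H" by (rule H.metric_space)
  interpret MK: Metric_space "carrier K" "hdist K" by (rule K.metric_space)
  note U = unitary_mapsD[OF Um]
  note d = hdist_unitary[OF H.inner_product_space_axioms K.inner_product_space_axioms Um]
  have "MK.mcomplete"
    unfolding MK.mcomplete_def
  proof (intro allI impI)
    fix \<sigma> assume \<sigma>: "MK.MCauchy \<sigma>"
    then have "\<forall>n. \<exists>x \<in> carrier H. \<sigma> n = U x" using U(7) unfolding MK.MCauchy_def by blast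
    then obtain \<tau> where \<tau>: "\<And>n. \<tau> n \<in> carrier H" "\<And>n. \<sigma> n = U (\<tau> n)" by metis
    have "MH.MCauchy \<tau>" using \<sigma> \<tau>(1) unfolding MH.MCauchy_def MK.MCauchy_def
      by (auto simp: \<tau>(2) d)
    then obtain l where l: "limitin MH.mtopology \<tau> l sequentially"
      using H.complete by (auto simp: MH.mcomplete_def)
    then have "limitin MK.mtopology \<sigma> (U l) sequentially"
      using \<tau> by (auto simp: MH.limit_metric_sequentially MK.limit_metric_sequentially d U(2))
    then show "\<exists>x. limitin MK.mtopology \<sigma> x sequentially" by blast
  qed
  then show ?thesis
    by (intro hilbert_space.intro hilbert_space_axioms.intro K.inner_product_space_axioms)
qed

lemma irrep_transport:
  assumes \<pi>: "(H, \<rho>) \<in> irreps G" and Um: "U \<in> unitary_maps H K"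
    and zero: "\<zero>\<^bsub>K\<^esub> = U \<zero>\<^bsub>H\<^esub>"
    and \<sigma>: "\<And>g v. \<lbrakk>g \<in> carrier G; v \<in> carrier H\<rbrakk> \<Longrightarrow> \<sigma> g (U v) = U (\<rho> g v)"
    and G: "group G"
  shows "(K, \<sigma>) \<in> irreps G" and "rep_equivalent G (H, \<rho>) (K, \<sigma>)"
proof -
  interpret G: group G by (fact G)
  note U = unitary_mapsD[OF Um]
  have ur: "unitary_rep G (H, \<rho>)" and ir: "irreducible_rep G (H, \<rho>)"
    using \<pi> by (auto simp: irreps_def)
  have Hs: "hilbert_space H" and \<rho>: "\<And>g. g \<in> carrier G \<Longrightarrow> \<rho> g \<in> unitary_maps H H"
    and \<rho>1: "\<And>v. v \<in> carrier H \<Longrightarrow> \<rho> \<one>\<^bsub>G\<^esub> v = v"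
    and \<rho>m: "\<And>g h v. \<lbrakk>g \<in> carrier G; h \<in> carrier G; v \<in> carrier H\<rbrakk> \<Longrightarrow>
      \<rho> (g \<otimes>\<^bsub>G\<^esub> h) v = \<rho> g (\<rho> h v)"
    using ur by (auto simp: unitary_rep_def)
  interpret H: hilbert_space H by (fact Hs)
  have Ks: "hilbert_space K" by (rule hilbert_space_transport[OF Hs Um zero])
  interpret K: hilbert_space K by (fact Ks)
  interpret MH: Metric_space "carrier H" "hdist H" by (rule H.metric_space)
  interpret MK: Metric_space "carrier K" "hdist K" by (rule K.metric_space)
  note d = hdist_unitary[OF H.inner_product_space_axioms K.inner_product_space_axioms Um]
  note \<rho>c = unitary_mapsD(2)[OF \<rho>]
  show eq: "rep_equivalent G (H, \<rho>) (K, \<sigma>)"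
    using Um \<sigma> by (auto simp: rep_equivalent_def intro!: bexI[of _ U])
  let ?V = "inv_into (carrier H) U"
  have inj: "inj_on U (carrier H)" using U(1) by (simp add: bij_betw_def)
  have V: "?V \<in> unitary_maps K H" by (rule unitary_maps_inv[OF Um H.inner_product_space_axioms])
  have cong: "f \<in> unitary_maps K K"
    if "g \<in> unitary_maps K K" "\<And>x. x \<in> carrier K \<Longrightarrow> f x = g x" for f g
  proof -
    have "bij_betw f (carrier K) (carrier K) = bij_betw g (carrier K) (carrier K)"
      using that(2) by (rule bij_betw_cong)
    then show ?thesis using that by (simp add: unitary_maps_def)
  qed
  have "unitary_rep G (K, \<sigma>)"
    unfolding unitary_rep_def split_conv
  proof (intro conjI ballI Ks)
    fix g assume g: "g \<in> carrier G"
    have "(U \<circ> \<rho> g) \<circ> ?V \<in> unitary_maps K K"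
      by (rule unitary_maps_comp[OF V unitary_maps_comp[OF \<rho>[OF g] Um]])
    then show "\<sigma> g \<in> unitary_maps K K"
    proof (rule cong)
      fix x assume "x \<in> carrier K"
      then obtain v where "v \<in> carrier H" "x = U v" using U(7) by blast
      then show "\<sigma> g x = ((U \<circ> \<rho> g) \<circ> ?V) x" using \<sigma>[OF g] inj by simp
    qed
  next
    fix v assume "v \<in> carrier K"
    then obtain v' where "v' \<in> carrier H" "v = U v'" using U(7) by blast
    then show "\<sigma> \<one>\<^bsub>G\<^esub> v = v" by (simp add: \<sigma> \<rho>1)
  next
    fix g h v assume gh: "g \<in> carrier G" "h \<in> carrier G" and "v \<in> carrier K"
    then obtain v' where "v' \<in> carrier H" "v = U v'" using U(7) by blast
    then show "\<sigma> (g \<otimes>\<^bsub>G\<^esub> h) v = \<sigma> g (\<sigma> h v)" using gh by (simp add: \<sigma> \<rho>m \<rho>c)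
  qed
  moreover have "irreducible_rep G (K, \<sigma>)"
    unfolding irreducible_rep_def split_conv
  proof (intro conjI allI impI)
    have "carrier H \<noteq> {\<zero>\<^bsub>H\<^esub>}" using ir by (simp add: irreducible_rep_def)
    then obtain x where "x \<in> carrier H" "x \<noteq> \<zero>\<^bsub>H\<^esub>" using H.M.zero_closed by blast
    then show "carrier K \<noteq> {\<zero>\<^bsub>K\<^esub>}" using U(2)[of x] U(6)[of x "\<zero>\<^bsub>H\<^esub>"] zero by auto
  next
    fix W
    assume "submodule W complex_ring K \<and> closedin MK.mtopology W \<and> (\<forall>g\<in>carrier G. \<sigma> g ` W \<subseteq> W)"
    then have W: "submodule W complex_ring K" and cl: "closedin MK.mtopology W"
      and inv: "\<And>g w. \<lbrakk>g \<in> carrier G; w \<in> W\<rbrakk> \<Longrightarrow> \<sigma> g w \<in> W" by auto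
    note WE = K.submoduleE[OF W]
    define W' where "W' = {x \<in> carrier H. U x \<in> W}"
    have im: "W = U ` W'"
      using WE(1) U(7) unfolding W'_def by blast
    have 0: "\<zero>\<^bsub>K\<^esub> \<in> W" using submodule.axioms(1)[OF W] subgroup.one_closed by fastforce
    have sub: "submodule W' complex_ring H"
    proof (rule H.submoduleI)
      show "W' \<subseteq> carrier H" by (auto simp: W'_def)
      show "\<zero>\<^bsub>H\<^esub> \<in> W'" using 0 zero by (simp add: W'_def)
      show sm: "a \<odot>\<^bsub>H\<^esub> x \<in> W'" if "x \<in> W'" for a x
        using that WE(4) by (simp add: W'_def U(4))
      show "x \<oplus>\<^bsub>H\<^esub> y \<in> W'" if "x \<in> W'" "y \<in> W'" for x y
        using that WE(5) by (simp add: W'_def U(3))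
      show "\<ominus>\<^bsub>H\<^esub> x \<in> W'" if x: "x \<in> W'" for x
      proof -
        have "x \<in> carrier H" using x by (simp add: W'_def)
        then have "\<ominus>\<^bsub>H\<^esub> x = (-1) \<odot>\<^bsub>H\<^esub> x"
          using H.minus_smult[of "\<zero>\<^bsub>H\<^esub>" x] by (simp add: a_minus_def)
        then show ?thesis using sm[OF x] by simp
      qed
    qed
    have "closedin MH.mtopology W'"
      unfolding MH.closedin_metric
    proof (intro conjI allI impI)
      show "W' \<subseteq> carrier H" by (auto simp: W'_def)
      fix x assume x: "x \<in> carrier H - W'"
      then have "U x \<in> carrier K - W" by (auto simp: W'_def U(2))
      then obtain r where r: "r > 0" "disjnt W (MK.mball (U x) r)"
        using cl by (auto simp: MK.closedin_metric)
      have "disjnt W' (MH.mball x r)"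
        unfolding disjnt_iff
      proof (intro allI notI)
        fix z assume z: "z \<in> W' \<and> z \<in> MH.mball x r"
        then have "U z \<in> W" "z \<in> carrier H" by (auto simp: W'_def)
        moreover have "U z \<in> MK.mball (U x) r" using z x by (auto simp: d U(2))
        ultimately show False using r(2) by (auto simp: disjnt_iff)
      qed
      then show "\<exists>r>0. disjnt W' (MH.mball x r)" using r(1) by blast
    qed
    moreover have "\<forall>g \<in> carrier G. \<rho> g ` W' \<subseteq> W'"
      using inv by (auto simp: W'_def \<rho>c \<sigma>[symmetric])
    ultimately have "W' = {\<zero>\<^bsub>H\<^esub>} \<or> W' = carrier H"
      using sub ir by (auto simp: irreducible_rep_def)
    then show "W = {\<zero>\<^bsub>K\<^esub>} \<or> W = carrier K"
      using U(1) by (auto simp: im zero bij_betw_def)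
  qed
  ultimately show "(K, \<sigma>) \<in> irreps G" by (simp add: irreps_def)
qed

theorem irrep_equivalent_coefficient_irrep:
  fixes G (structure) and \<pi> :: "('g, 'v) rep"
  assumes G: "group G" and \<pi>: "\<pi> \<in> irreps G"
  shows "\<exists>\<sigma> :: ('g, 'g \<Rightarrow> complex) rep. \<sigma> \<in> irreps G \<and> rep_equivalent G \<pi> \<sigma>"
proof -
  interpret G: group G by (fact G)
  obtain H \<rho> where p: "\<pi> = (H, \<rho>)" by (cases \<pi>)
  have ur: "unitary_rep G (H, \<rho>)" and ir: "irreducible_rep G (H, \<rho>)"
    using \<pi> by (auto simp: irreps_def p)
  have Hs: "hilbert_space H" and \<rho>: "\<And>g. g \<in> carrier G \<Longrightarrow> \<rho> g \<in> unitary_maps H H"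
    and \<rho>1: "\<And>v. v \<in> carrier H \<Longrightarrow> \<rho> \<one> v = v"
    and \<rho>m: "\<And>g h v. \<lbrakk>g \<in> carrier G; h \<in> carrier G; v \<in> carrier H\<rbrakk> \<Longrightarrow>
      \<rho> (g \<otimes> h) v = \<rho> g (\<rho> h v)"
    using ur by (auto simp: unitary_rep_def)
  interpret H: hilbert_space H by (fact Hs)
  interpret MH: Metric_space "carrier H" "hdist H" by (rule H.metric_space)
  note \<rho>c = unitary_mapsD(2)[OF \<rho>]
  have "carrier H \<noteq> {\<zero>\<^bsub>H\<^esub>}" using ir by (simp add: irreducible_rep_def)
  then obtain v where v: "v \<in> carrier H" "v \<noteq> \<zero>\<^bsub>H\<^esub>" using H.M.zero_closed by blast
  define f where "f = (\<lambda>w g. if g \<in> carrier G then cinner H w (\<rho> g v) else 0)"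
  define W where "W = {w \<in> carrier H. \<forall>g \<in> carrier G. cinner H w (\<rho> g v) = 0}"
  have "submodule W complex_ring H"
  proof (rule H.submoduleI)
    show "W \<subseteq> carrier H" "\<zero>\<^bsub>H\<^esub> \<in> W" by (auto simp: W_def \<rho>c v)
    show sm: "a \<odot>\<^bsub>H\<^esub> x \<in> W" if "x \<in> W" for a x
      using that by (simp add: W_def H.cinner_smult_left \<rho>c v)
    show "x \<oplus>\<^bsub>H\<^esub> y \<in> W" if "x \<in> W" "y \<in> W" for x y
      using that by (simp add: W_def H.cinner_add_left \<rho>c v)
    show "\<ominus>\<^bsub>H\<^esub> x \<in> W" if x: "x \<in> W" for x
    proof -
      have "x \<in> carrier H" using x by (simp add: W_def)
      then have "\<ominus>\<^bsub>H\<^esub> x = (-1) \<odot>\<^bsub>H\<^esub> x"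
        using H.minus_smult[of "\<zero>\<^bsub>H\<^esub>" x] by (simp add: a_minus_def)
      then show ?thesis using sm[OF x] by simp
    qed
  qed
  moreover have "closedin MH.mtopology W"
    unfolding MH.closedin_metric
  proof (intro conjI allI impI)
    show "W \<subseteq> carrier H" by (auto simp: W_def)
    fix x assume "x \<in> carrier H - W"
    then obtain g where x: "x \<in> carrier H" and g: "g \<in> carrier G"
      and nz: "cinner H x (\<rho> g v) \<noteq> 0" by (auto simp: W_def)
    let ?u = "\<rho> g v"
    have u: "?u \<in> carrier H" by (simp add: \<rho>c g v)
    have un: "hnorm H ?u > 0"
      using H.cauchy_schwarz[OF x u] nz H.hnorm_nonneg[OF u] by (cases "hnorm H ?u = 0") auto
    define r where "r = cmod (cinner H x ?u) / hnorm H ?u"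
    have "w \<notin> MH.mball x r" if w: "w \<in> W" for w
    proof
      assume "w \<in> MH.mball x r"
      then have wH: "w \<in> carrier H" and lt: "hnorm H (x \<ominus>\<^bsub>H\<^esub> w) < r"
        by (auto simp: hdist_def)
      have "cinner H x ?u = cinner H (x \<ominus>\<^bsub>H\<^esub> w) ?u"
        using w g x wH u by (simp add: H.cinner_minus_left W_def)
      then have "cmod (cinner H x ?u) \<le> hnorm H (x \<ominus>\<^bsub>H\<^esub> w) * hnorm H ?u"
        using H.cauchy_schwarz[of "x \<ominus>\<^bsub>H\<^esub> w" ?u] x wH u by simp
      also have "\<dots> < r * hnorm H ?u" using lt un by simp
      finally show False using un by (simp add: r_def)
    qed
    moreover have "r > 0" using nz un by (simp add: r_def)
    ultimately show "\<exists>r>0. disjnt W (MH.mball x r)" by (auto simp: disjnt_iff)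
  qed
  moreover have "\<forall>g \<in> carrier G. \<rho> g ` W \<subseteq> W"
  proof (intro ballI subsetI)
    fix g y assume g: "g \<in> carrier G" and "y \<in> \<rho> g ` W"
    then obtain w where w: "w \<in> W" "y = \<rho> g w" by auto
    have wH: "w \<in> carrier H" using w by (simp add: W_def)
    have "cinner H (\<rho> g w) (\<rho> h v) = 0" if h: "h \<in> carrier G" for h
    proof -
      have "\<rho> h v = \<rho> g (\<rho> (inv g \<otimes> h) v)"
        using g h v \<rho>m[of g "inv g \<otimes> h" v] by (simp add: G.m_assoc[symmetric])
      then have "cinner H (\<rho> g w) (\<rho> h v) = cinner H w (\<rho> (inv g \<otimes> h) v)"
        using unitary_mapsD(5)[OF \<rho>[OF g] wH, of "\<rho> (inv g \<otimes> h) v"] g h v by (simp add: \<rho>c)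
      then show ?thesis using w g h by (simp add: W_def)
    qed
    then show "y \<in> W" using w g wH by (simp add: W_def \<rho>c)
  qed
  ultimately have "W = {\<zero>\<^bsub>H\<^esub>} \<or> W = carrier H"
    using ir by (auto simp: irreducible_rep_def)
  moreover have "v \<notin> W"
  proof
    assume "v \<in> W"
    then have "cinner H v (\<rho> \<one> v) = 0" by (simp add: W_def)
    then have "cinner H v v = 0" by (simp only: \<rho>1[OF v(1)])
    then show False using H.cinner_pos[OF v] by simp
  qed
  ultimately have W0: "W = {\<zero>\<^bsub>H\<^esub>}" using v by auto
  have inj: "inj_on f (carrier H)"
  proof (rule inj_onI)
    fix x y assume x: "x \<in> carrier H" and y: "y \<in> carrier H" and eq: "f x = f y"
    have "cinner H x (\<rho> g v) = cinner H y (\<rho> g v)" if "g \<in> carrier G" for g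
      using fun_cong[OF eq, of g] that by (simp add: f_def)
    then have "x \<ominus>\<^bsub>H\<^esub> y \<in> W" using x y by (simp add: W_def H.cinner_minus_left \<rho>c v)
    then show "x = y" using W0 x y by (simp add: H.right_minus_eq)
  qed
  let ?i = "inv_into (carrier H) f"
  have i: "?i (f x) = x" if "x \<in> carrier H" for x using inj that by simp
  define K :: "('g \<Rightarrow> complex) hilbert" where "K =
    \<lparr>carrier = f ` carrier H, mult = undefined, one = undefined,
     zero = f \<zero>\<^bsub>H\<^esub>, add = (\<lambda>x y. f (?i x \<oplus>\<^bsub>H\<^esub> ?i y)),
     smult = (\<lambda>a x. f (a \<odot>\<^bsub>H\<^esub> ?i x)), cinner = (\<lambda>x y. cinner H (?i x) (?i y))\<rparr>"
  have "f \<in> unitary_maps H K"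
    using inj by (auto simp: unitary_maps_def K_def i bij_betw_def)
  moreover have "\<zero>\<^bsub>K\<^esub> = f \<zero>\<^bsub>H\<^esub>" by (simp add: K_def)
  moreover have "f (\<rho> g (?i (f w))) = f (\<rho> g w)" if "w \<in> carrier H" for g w by (simp add: i that)
  ultimately show ?thesis
    using irrep_transport[of H \<rho> G f K "\<lambda>g x. f (\<rho> g (?i x))"] \<pi> G unfolding p by blast
qed

end

theory Submission
  imports Defs
begin

text \<open>
  For any self-map \<open>T\<close>, the numbers of fixed points of its iterates satisfy the congruences
  in question. Indeed, a point of least period \<open>p\<close> is fixed by \<open>T\<^bsup>n/d\<^esup>\<close> exactly when \<open>p\<close>
  divides \<open>n/d\<close>, so it contributes \<open>\<Sum>\<^bsub>d | n/p\<^esub> \<mu>(d)\<close> to the Moebius sum, which is \<open>1\<close> for \<open>p = n\<close>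
  and \<open>0\<close> otherwise. Hence the Moebius sum counts the points of least period \<open>n\<close>, and these
  fall into orbits of size \<open>n\<close>. This is \<open>moebius_sum_fixed_points\<close>.

  By the twisted Burnside--Frobenius property, \<open>R(\<phi>\<^sup>n)\<close> is the number of f-points of \<open>\<phi>\<^sup>n\<close>
  in \<open>X\<close>, and these should be the fixed points of the \<open>n\<close>-th iterate of \<open>[\<rho>] \<mapsto> [\<rho> \<circ> \<phi>]\<close>.
  The difficulty is that \<open>\<phi>\<close> need not be surjective: \<open>\<rho> \<circ> \<phi>\<close> may be reducible even though \<open>\<rho>\<close>
  is irreducible, so there is no such self-map of the dual. It does exist on the f-points, however.
  If \<open>\<rho>\<close> is equivalent to \<open>\<rho> \<circ> \<phi>\<^sup>m\<close> with \<open>m \<ge> 1\<close>, then a subspace invariant under \<open>\<rho>(\<phi>(G))\<close> is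
  invariant under the smaller set \<open>\<rho>(\<phi>\<^sup>m(G))\<close>, which acts irreducibly; so \<open>\<rho> \<circ> \<phi>\<close> is irreducible,
  and it is again equivalent to its composition with \<open>\<phi>\<^sup>m\<close>. This is \<open>periodic_rep_comp\<close>.
  Composition with \<open>\<phi>\<close> changes neither the Hilbert space nor the property of factoring through
  a finite group, so the three choices of \<open>X\<close> are treated alike: on the union \<open>P\<close> of the sets of
  f-points in \<open>X\<close> of all \<open>\<phi>\<^sup>m\<close>, \<open>m \<ge> 1\<close>, the map is an honest self-map
  (\<open>f_points_eq_fixed_points\<close>), and the congruence for self-maps applies.
\<close>

section \<open>Moebius sums\<close>

lemma moebius_mu_prime_mult:
  assumes "prime p" "\<not> p dvd d"
  shows "moebius_mu (p * d) = - moebius_mu d"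
proof -
  have d: "d \<noteq> 0" using assms(2) by (metis dvd_0_right)
  have cop: "coprime p d" using assms by (simp add: prime_imp_coprime)
  have pf: "prime_factors (p * d) = insert p (prime_factors d)"
    using assms(1) d by (simp add: prime_factors_product prime_prime_factors)
  have "squarefree (p * d) \<longleftrightarrow> squarefree d"
    using cop assms(1) by (auto simp: squarefree_mult_coprime squarefree_prime intro: squarefree_multD)
  moreover have "p \<notin> prime_factors d" using assms(2) by auto
  ultimately show ?thesis unfolding moebius_mu_def pf by simp
qed

text \<open>
  For a prime \<open>p\<close> dividing \<open>m\<close>, multiplication by \<open>p\<close> pairs the squarefree divisors of \<open>m\<close> prime
  to \<open>p\<close> with those divisible by \<open>p\<close> and reverses the sign of \<open>\<mu>\<close>, so the sum cancels.
\<close>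

lemma sum_moebius_mu_divisors:
  assumes "m > 0"
  shows "(\<Sum>d | d dvd m. moebius_mu d) = (if m = 1 then 1 else 0)"
proof (cases "m = 1")
  case True
  then show ?thesis by (simp add: moebius_mu_def)
next
  case False
  then obtain p where p: "prime p" "p dvd m" using prime_factor_nat by blast
  have fin: "finite {d. d dvd m}" using assms by simp
  let ?D = "{d. d dvd m \<and> squarefree d}"
  let ?A = "{d \<in> ?D. \<not> p dvd d}" and ?B = "{d \<in> ?D. p dvd d}"
  have "bij_betw ((*) p) ?A ?B"
  proof (rule bij_betwI')
    fix x y show "(p * x = p * y) = (x = y)" using p by (simp add: prime_gt_0_nat)
  next
    fix d assume "d \<in> ?A"
    moreover from this p have "coprime p d" by (simp add: prime_imp_coprime)
    ultimately show "p * d \<in> ?B"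
      using p by (auto simp: squarefree_mult_coprime squarefree_prime divides_mult)
  next
    fix e assume e: "e \<in> ?B"
    then obtain d where d: "e = p * d" by (auto elim: dvdE)
    have "\<not> p dvd d"
    proof
      assume "p dvd d"
      then have "p ^ 2 dvd e" by (simp add: d power2_eq_square)
      then show False using e p(1) squarefreeD[of e p] by auto
    qed
    then have "d \<in> ?A" using e d dvd_mult_right squarefree_multD[of p d] by auto
    then show "\<exists>d \<in> ?A. e = p * d" using d by blast
  qed
  then have "(\<Sum>d\<in>?B. moebius_mu d) = (\<Sum>d\<in>?A. moebius_mu (p * d))"
    by (rule sum.reindex_bij_betw[symmetric])
  also have "\<dots> = - (\<Sum>d\<in>?A. moebius_mu d)"
    using p(1) by (simp add: moebius_mu_prime_mult sum_negf)
  finally have B: "(\<Sum>d\<in>?B. moebius_mu d) = - (\<Sum>d\<in>?A. moebius_mu d)" .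
  have "(\<Sum>d | d dvd m. moebius_mu d) = (\<Sum>d\<in>?D. moebius_mu d)"
    by (rule sum.mono_neutral_right) (use fin in \<open>auto simp: moebius_mu_def\<close>)
  also have "\<dots> = (\<Sum>d\<in>?A \<union> ?B. moebius_mu d)" by (rule sum.cong) auto
  also have "\<dots> = (\<Sum>d\<in>?A. moebius_mu d) + (\<Sum>d\<in>?B. moebius_mu d)"
    by (rule sum.union_disjoint) (use fin in auto)
  finally show ?thesis using B False by simp
qed


section \<open>Periodic points of a self-map\<close>

lemma funpow_funpow: "(T ^^ i) ((T ^^ j) x) = (T ^^ (i + j)) x"
  by (simp add: funpow_add)

definition least_period :: "('a \<Rightarrow> 'a) \<Rightarrow> 'a \<Rightarrow> nat" where
  "least_period T x = (LEAST k. k > 0 \<and> (T ^^ k) x = x)"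

lemma funpow_fixed_iff_least_period_dvd:
  assumes "n > 0" "(T ^^ n) x = x"
  shows "least_period T x > 0" and "(T ^^ k) x = x \<longleftrightarrow> least_period T x dvd k"
proof -
  let ?p = "least_period T x"
  have p: "?p > 0 \<and> (T ^^ ?p) x = x"
    unfolding least_period_def by (rule LeastI[of _ n]) (use assms in simp)
  then show "?p > 0" by simp
  have mod: "(T ^^ k) x = (T ^^ (k mod ?p)) x" using p funpow_mod_eq by metis
  show "(T ^^ k) x = x \<longleftrightarrow> ?p dvd k"
  proof
    assume "(T ^^ k) x = x"
    then have "\<not> (k mod ?p > 0)"
      using mod p not_less_Least[of "k mod ?p" "\<lambda>k. k > 0 \<and> (T ^^ k) x = x"]
      by (auto simp: least_period_def[symmetric])
    then show "?p dvd k" by auto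
  next
    assume "?p dvd k"
    then show "(T ^^ k) x = x" using mod by (simp add: dvd_eq_mod_eq_0)
  qed
qed

lemma least_period_funpow:
  assumes n: "n > 0" and x: "(T ^^ n) x = x"
  shows "least_period T ((T ^^ i) x) = least_period T x"
proof -
  have shift: "(T ^^ k) ((T ^^ i) x) = (T ^^ i) ((T ^^ k) x)" for k
    by (simp add: funpow_funpow add.commute)
  have "(T ^^ k) ((T ^^ i) x) = (T ^^ i) x \<longleftrightarrow> (T ^^ k) x = x" for k
  proof
    assume eq: "(T ^^ k) ((T ^^ i) x) = (T ^^ i) x"
    \<comment> \<open>Complete the first \<open>i\<close> steps to a multiple of \<open>n\<close>, which undoes them.\<close>
    define j where "j = n * i - i"
    have "j + i = n * i" using n by (simp add: j_def)
    then have ret: "(T ^^ j) ((T ^^ i) x) = x"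
      using funpow_mod_eq[OF x, of "n * i"] by (simp add: funpow_funpow)
    have "(T ^^ k) x = (T ^^ k) ((T ^^ j) ((T ^^ i) x))" by (simp only: ret)
    also have "\<dots> = (T ^^ j) ((T ^^ k) ((T ^^ i) x))"
      by (simp only: funpow_funpow add.left_commute)
    finally show "(T ^^ k) x = x" by (simp only: eq ret)
  qed (simp add: shift)
  then show ?thesis by (simp add: least_period_def)
qed

text \<open>
  The points of least period \<open>n\<close> are partitioned into orbits, the classes of \<open>r\<close> in the proof, and
  each orbit consists of \<open>n\<close> points.
\<close>

lemma dvd_card_least_period:
  assumes TS: "T ` S \<subseteq> S" and n: "n > 0" and fin: "finite {x \<in> S. (T ^^ n) x = x}"
  shows "n dvd card {x \<in> S. (T ^^ n) x = x \<and> least_period T x = n}" (is "n dvd card ?A")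
proof -
  define r where "r = {(x, y). x \<in> ?A \<and> (\<exists>i. y = (T ^^ i) x)}"
  have TS': "(T ^^ i) x \<in> S" if "x \<in> S" for x i
    using that TS by (induction i) auto
  have closed: "(T ^^ i) x \<in> ?A" if "x \<in> ?A" for x i
  proof -
    have "(T ^^ n) ((T ^^ i) x) = (T ^^ i) x"
      using that funpow_funpow[of n T i x] funpow_funpow[of i T n x] by (simp add: add.commute)
    then show ?thesis using that n by (simp add: TS' least_period_funpow)
  qed
  have red: "(T ^^ i) x = (T ^^ (i mod n)) x" if "x \<in> ?A" for x i
    using that funpow_mod_eq[of n T x i] by simp
  have "equiv ?A r"
  proof (rule equivI)
    show "r \<subseteq> ?A \<times> ?A" using closed unfolding r_def by blast
    show "refl_on ?A r" unfolding refl_on_def r_def by (auto intro: exI[of _ 0])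
    show "sym r"
    proof (rule symI)
      fix x y assume "(x, y) \<in> r"
      then obtain i where x: "x \<in> ?A" and y: "y = (T ^^ i) x" unfolding r_def by blast
      \<comment> \<open>As \<open>T ^^ n\<close> fixes \<open>x\<close>, going on to a multiple of \<open>n\<close> steps leads back to \<open>x\<close>.\<close>
      have "i + (n * i - i) = n * i" using n by simp
      then have "(T ^^ (n * i - i)) y = (T ^^ (n * i)) x"
        unfolding y by (simp only: funpow_funpow add.commute)
      also have "\<dots> = x" using red[OF x, of "n * i"] by simp
      finally have "x = (T ^^ (n * i - i)) y" by simp
      then show "(y, x) \<in> r" using closed[OF x, of i] unfolding r_def y by blast
    qed
    show "trans r"
    proof (rule transI)
      fix x y z assume "(x, y) \<in> r" "(y, z) \<in> r"
      then obtain i j where "x \<in> ?A" "z = (T ^^ j) ((T ^^ i) x)" unfolding r_def by blast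
      then have "x \<in> ?A" "z = (T ^^ (j + i)) x" by (simp_all add: funpow_add)
      then show "(x, z) \<in> r" unfolding r_def by blast
    qed
  qed
  moreover have "n dvd card C" if "C \<in> ?A // r" for C
  proof -
    from that obtain x where x: "x \<in> ?A" and C: "C = r `` {x}" by (auto elim: quotientE)
    have "C = (\<lambda>i. (T ^^ i) x) ` {..<n}"
      using x red[OF x] n unfolding C r_def by (auto intro!: image_eqI[of _ _ "_ mod n"])
    moreover have "inj_on (\<lambda>i. (T ^^ i) x) {..<n}"
    proof (rule linorder_inj_onI)
      fix i j assume ij: "i < j" "i \<in> {..<n}" "j \<in> {..<n}"
      show "(T ^^ i) x \<noteq> (T ^^ j) x"
      proof
        let ?y = "(T ^^ i) x"
        assume eq: "?y = (T ^^ j) x"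
        then have "(T ^^ (j - i)) ?y = ?y"
          using ij by (subst funpow_funpow) (simp add: eq)
        moreover have "?y \<in> ?A" using closed[OF x] .
        ultimately have "n dvd j - i"
          using funpow_fixed_iff_least_period_dvd(2)[of n T ?y "j - i"] n by simp
        then show False using ij nat_dvd_not_less[of "j - i" n] by (simp add: less_imp_diff_less)
      qed
    qed auto
    ultimately show "n dvd card C" by (simp add: card_image)
  qed
  moreover have "finite ?A" by (rule finite_subset[OF _ fin]) blast
  ultimately show ?thesis by (intro equiv_imp_dvd_card[of ?A r n])
qed

text \<open>
  Exchanging the two summations gives each fixed point of \<open>T ^^ n\<close> the weight \<open>\<Sum>\<^bsub>d | n/p\<^esub> \<mu>(d)\<close>, \<open>p\<close> its
  least period, so that only the points of least period \<open>n\<close> survive.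
\<close>

lemma moebius_sum_fixed_points:
  assumes TS: "T ` S \<subseteq> S" and n: "n > 0" and fin: "finite {x \<in> S. (T ^^ n) x = x}"
  shows "[(\<Sum>d | d dvd n. moebius_mu d * int (card {x \<in> S. (T ^^ (n div d)) x = x})) = 0]
    (mod (int n))"
proof -
  let ?F = "{x \<in> S. (T ^^ n) x = x}" and ?p = "least_period T"
  have dvdn: "?p x dvd n" if "x \<in> ?F" for x
    using that n funpow_fixed_iff_least_period_dvd(2)[of n T x n] by simp
  have pos: "?p x > 0" if "x \<in> ?F" for x
    using that n funpow_fixed_iff_least_period_dvd(1)[of n T x] by simp
  \<comment> \<open>A point of period \<open>p\<close> is fixed by \<open>T ^^ (n div d)\<close> exactly for the divisors \<open>d\<close> of \<open>n div p\<close>.\<close>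
  have fixed: "x \<in> S \<and> (T ^^ (n div d)) x = x \<longleftrightarrow> x \<in> ?F \<and> d dvd n div ?p x"
    if d: "d dvd n" for x d
  proof -
    have nd: "n div d > 0" using d n by (auto elim!: dvdE)
    have eq: "?p x dvd n div d \<longleftrightarrow> d dvd n div ?p x" if "?p x dvd n"
    proof -
      have "d > 0" "?p x > 0" using d that n by (auto intro: Nat.gr0I)
      then show ?thesis using d that by (metis dvd_div_iff_mult mult.commute less_numeral_extra(3))
    qed
    show ?thesis
    proof
      assume x: "x \<in> S \<and> (T ^^ (n div d)) x = x"
      then have p: "?p x dvd n div d"
        and k: "\<And>k. (T ^^ k) x = x \<longleftrightarrow> ?p x dvd k"
        using nd funpow_fixed_iff_least_period_dvd(2)[of "n div d" T x] by auto
      have "?p x dvd n"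
        using p dvd_mult_left[of "n div d" d n] d by (auto intro: dvd_trans)
      then show "x \<in> ?F \<and> d dvd n div ?p x" using x p k eq by simp
    next
      assume x: "x \<in> ?F \<and> d dvd n div ?p x"
      then show "x \<in> S \<and> (T ^^ (n div d)) x = x"
        using n dvdn[of x] eq funpow_fixed_iff_least_period_dvd(2)[of n T x "n div d"] by simp
    qed
  qed
  have "(\<Sum>d | d dvd n. moebius_mu d * int (card {x \<in> S. (T ^^ (n div d)) x = x}))
      = (\<Sum>d | d dvd n. \<Sum>x\<in>?F. if d dvd n div ?p x then moebius_mu d else 0)"
  proof (rule sum.cong)
    fix d assume "d \<in> {d. d dvd n}"
    then have "{x \<in> S. (T ^^ (n div d)) x = x} = {x \<in> ?F. d dvd n div ?p x}"
      using fixed by blast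
    then show "moebius_mu d * int (card {x \<in> S. (T ^^ (n div d)) x = x})
      = (\<Sum>x\<in>?F. if d dvd n div ?p x then moebius_mu d else 0)"
      using fin by (simp add: sum.If_cases Int_def conj_commute conj_left_commute)
  qed simp
  also have "\<dots> = (\<Sum>x\<in>?F. \<Sum>d | d dvd n. if d dvd n div ?p x then moebius_mu d else 0)"
    by (rule sum.swap)
  also have "\<dots> = (\<Sum>x\<in>?F. if ?p x = n then 1 else 0)"
  proof (rule sum.cong)
    fix x assume x: "x \<in> ?F"
    let ?m = "n div ?p x"
    have m: "?m > 0" using dvdn[OF x] n by (auto elim!: dvdE)
    have "?m dvd n" using dvdn[OF x] by (metis dvd_div_mult_self dvd_triv_left)
    then have "{d. d dvd n \<and> d dvd ?m} = {d. d dvd ?m}" by (auto intro: dvd_trans)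
    then have "(\<Sum>d | d dvd n. if d dvd ?m then moebius_mu d else 0) = (\<Sum>d | d dvd ?m. moebius_mu d)"
      using n by (simp add: sum.If_cases Int_def)
    also have "\<dots> = (if ?m = 1 then 1 else 0)" using m by (rule sum_moebius_mu_divisors)
    also have "?m = 1 \<longleftrightarrow> ?p x = n"
      using dvdn[OF x] pos[OF x] by (auto elim!: dvdE)
    finally show "(\<Sum>d | d dvd n. if d dvd ?m then moebius_mu d else 0)
      = (if ?p x = n then 1 else 0)" .
  qed simp
  also have "\<dots> = int (card {x \<in> S. (T ^^ n) x = x \<and> ?p x = n})"
    using fin by (simp add: sum.If_cases Int_def conj_assoc)
  finally show ?thesis
    using dvd_card_least_period[OF TS n fin] by (simp add: cong_0_iff)
qed


section \<open>Composing representations with an endomorphism\<close>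

lemma rep_comp_rep_comp: "rep_comp (rep_comp \<pi> f) g = rep_comp \<pi> (f \<circ> g)"
  by (simp add: rep_comp_def comp_def)

lemma rep_comp_id: "rep_comp \<pi> id = \<pi>"
  by (simp add: rep_comp_def)

lemma hom_funpow:
  assumes "group G" "\<phi> \<in> hom G G"
  shows "\<phi> ^^ k \<in> hom G G"
  using assms by (induction k) (auto simp: hom_def Pi_iff)

lemma unitary_rep_comp:
  assumes "group F" "group G" "f \<in> hom F G" "unitary_rep G \<pi>"
  shows "unitary_rep F (rep_comp \<pi> f)"
proof -
  have "f g \<in> carrier G" if "g \<in> carrier F" for g
    using assms(3) that by (auto simp: hom_def)
  moreover have "f \<one>\<^bsub>F\<^esub> = \<one>\<^bsub>G\<^esub>" using assms(1-3) by (metis hom_one)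
  moreover have "f (g \<otimes>\<^bsub>F\<^esub> h) = f g \<otimes>\<^bsub>G\<^esub> f h" if "g \<in> carrier F" "h \<in> carrier F" for g h
    using assms(3) that by (simp add: hom_mult)
  ultimately show ?thesis
    using assms(4) by (auto simp: unitary_rep_def rep_comp_def split: prod.splits)
qed

lemma unitary_maps_zero:
  assumes "U \<in> unitary_maps H K" "inner_product_space H" "inner_product_space K"
  shows "U \<zero>\<^bsub>H\<^esub> = \<zero>\<^bsub>K\<^esub>"
proof -
  interpret H: inner_product_space H by fact
  interpret K: inner_product_space K by fact
  note U = unitary_mapsD[OF assms(1)]
  have "cinner K (U \<zero>\<^bsub>H\<^esub>) (U \<zero>\<^bsub>H\<^esub>) = 0" by (simp add: U(5))
  then show ?thesis using K.cinner_pos[of "U \<zero>\<^bsub>H\<^esub>"] U(2) by fastforce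
qed

lemma irreps_rep_equivalent:
  assumes G: "group G" and \<pi>: "\<pi> \<in> irreps G" and eq: "rep_equivalent G \<pi> \<sigma>"
    and \<sigma>: "unitary_rep G \<sigma>"
  shows "\<sigma> \<in> irreps G"
proof -
  obtain H \<rho> K \<tau> where p: "\<pi> = (H, \<rho>)" "\<sigma> = (K, \<tau>)" by (cases \<pi>, cases \<sigma>)
  from eq obtain U where U: "U \<in> unitary_maps H K"
    and i: "\<And>g v. \<lbrakk>g \<in> carrier G; v \<in> carrier H\<rbrakk> \<Longrightarrow> U (\<rho> g v) = \<tau> g (U v)"
    unfolding rep_equivalent_def p split_conv by blast
  have "inner_product_space H" "inner_product_space K"
    using \<pi> \<sigma> by (auto simp: irreps_def unitary_rep_def p hilbert_inner)
  then have "\<zero>\<^bsub>K\<^esub> = U \<zero>\<^bsub>H\<^esub>" using unitary_maps_zero[OF U] by simp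
  then show ?thesis using irrep_transport(1)[OF _ U _ _ G] \<pi> i unfolding p by metis
qed

text \<open>
  The operators of \<open>F\<close> are among those of \<open>G\<close>, so they have at least as many invariant subspaces.
\<close>

lemma irreducible_rep_of_comp:
  assumes "irreducible_rep F (rep_comp \<pi> f)" "f \<in> carrier F \<rightarrow> carrier G"
  shows "irreducible_rep G \<pi>"
proof -
  obtain H \<rho> where p: "\<pi> = (H, \<rho>)" by (cases \<pi>)
  have inv: "\<forall>g\<in>carrier F. \<rho> (f g) ` W \<subseteq> W" if "\<forall>g\<in>carrier G. \<rho> g ` W \<subseteq> W" for W
    using that assms(2) by blast
  show ?thesis
    using assms(1) inv unfolding irreducible_rep_def rep_comp_def p fst_conv snd_conv split_conv
    by blast
qed

text \<open>
  A subspace invariant under \<open>\<pi> \<circ> \<phi>\<close> is invariant under \<open>\<pi> \<circ> \<phi>\<^sup>m\<close>, which is irreducible because it is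
  equivalent to \<open>\<pi>\<close>. The second conclusion allows this argument to be repeated for all \<open>\<pi> \<circ> \<phi>\<^sup>k\<close>.
  For a general irreducible \<open>\<pi>\<close>, already \<open>\<pi> \<circ> \<phi>\<close> can be reducible.
\<close>

lemma periodic_rep_comp:
  assumes G: "group G" and \<phi>: "\<phi> \<in> hom G G" and \<pi>: "\<pi> \<in> irreps G"
    and m: "m > 0" and per: "rep_equivalent G \<pi> (rep_comp \<pi> (\<phi> ^^ m))"
  shows "rep_comp \<pi> (\<phi> ^^ k) \<in> irreps G"
    and "rep_equivalent G (rep_comp \<pi> (\<phi> ^^ k)) (rep_comp (rep_comp \<pi> (\<phi> ^^ k)) (\<phi> ^^ m))"
proof -
  note \<phi>k = hom_funpow[OF G \<phi>]
  have into: "\<phi> ^^ i \<in> carrier G \<rightarrow> carrier G" for i using \<phi>k[of i] by (simp add: hom_def)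
  have u: "unitary_rep G \<pi>" using \<pi> by (simp add: irreps_def)
  show eq: "rep_equivalent G (rep_comp \<pi> (\<phi> ^^ k)) (rep_comp (rep_comp \<pi> (\<phi> ^^ k)) (\<phi> ^^ m))" for k
    using rep_equivalent_comp[OF per into[of k]]
    by (simp add: rep_comp_rep_comp funpow_add[symmetric] add.commute)
  show "rep_comp \<pi> (\<phi> ^^ k) \<in> irreps G"
  proof (induction k)
    case 0
    show ?case using \<pi> by (simp add: rep_comp_id flip: id_def)
  next
    case (Suc k)
    let ?\<sigma> = "rep_comp \<pi> (\<phi> ^^ k)"
    have u: "unitary_rep G (rep_comp \<pi> (\<phi> ^^ i))" for i
      by (rule unitary_rep_comp[OF G G \<phi>k u])
    have "rep_comp ?\<sigma> (\<phi> ^^ m) \<in> irreps G"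
      by (rule irreps_rep_equivalent[OF G Suc.IH eq]) (simp add: rep_comp_rep_comp u flip: funpow_add)
    \<comment> \<open>Now \<open>\<sigma> \<circ> \<phi>\<^sup>m = (\<sigma> \<circ> \<phi>) \<circ> \<phi>\<^bsup>m-1\<^esup>\<close>, so its irreducibility passes to \<open>\<sigma> \<circ> \<phi>\<close>.\<close>
    moreover have "\<phi> ^^ k \<circ> \<phi> ^^ m = \<phi> ^^ Suc k \<circ> \<phi> ^^ (m - 1)"
    proof -
      have "k + m = Suc k + (m - 1)" using m by simp
      then show ?thesis unfolding funpow_add[symmetric] by (rule arg_cong)
    qed
    ultimately have "irreducible_rep G (rep_comp (rep_comp \<pi> (\<phi> ^^ Suc k)) (\<phi> ^^ (m - 1)))"
      by (simp only: irreps_def rep_comp_rep_comp mem_Collect_eq)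
    then show ?case
      using irreducible_rep_of_comp[OF _ into] u by (simp add: irreps_def del: funpow.simps)
  qed
qed

lemma finite_rep_comp:
  assumes "finite_rep G \<pi>" "\<phi> \<in> hom G G"
  shows "finite_rep G (rep_comp \<pi> \<phi>)"
proof -
  obtain F :: "nat monoid" and f \<tau> where F: "group F" "finite (carrier F)" "f \<in> hom G F"
      "unitary_rep F (fst \<pi>, \<tau>)"
    and \<tau>: "\<And>g v. \<lbrakk>g \<in> carrier G; v \<in> carrier (fst \<pi>)\<rbrakk> \<Longrightarrow> snd \<pi> g v = \<tau> (f g) v"
    using assms(1) unfolding finite_rep_def by blast
  have "f \<circ> \<phi> \<in> hom G F" using assms(2) F(3) by (auto simp: hom_def Pi_iff)
  then show ?thesis
    using F \<tau> assms(2) unfolding finite_rep_def rep_comp_def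
    by (intro exI[of _ F] exI[of _ "f \<circ> \<phi>"] exI[of _ \<tau>]) (auto simp: hom_def Pi_iff)
qed


section \<open>The induced map on the dual\<close>

text \<open>
  This is \<open>[\<pi>] \<mapsto> [\<pi> \<circ> \<phi>]\<close>, written as the set of all representations equivalent to some irreducible
  \<open>\<pi> \<circ> \<phi>\<close> in order to avoid a choice of \<open>\<pi>\<close>. A class whose compositions with \<open>\<phi>\<close> are reducible is
  mapped to the empty set, which is not a point of the dual.
\<close>

definition dual_map ::
    "('g, 'm) monoid_scheme \<Rightarrow> ('g \<Rightarrow> 'g) \<Rightarrow> ('g, 'v) rep set \<Rightarrow> ('g, 'v) rep set" where
  "dual_map G \<phi> c = irrep_relation G `` ((\<lambda>\<pi>. rep_comp \<pi> \<phi>) ` c)"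

lemma dual_map_class:
  assumes "\<pi> \<in> irreps G" "rep_comp \<pi> \<phi> \<in> irreps G" "\<phi> \<in> hom G G"
  shows "dual_map G \<phi> (irrep_relation G `` {\<pi>}) = irrep_relation G `` {rep_comp \<pi> \<phi>}"
proof -
  have "rep_equivalent G (rep_comp \<pi> \<phi>) \<tau>"
    if "rep_equivalent G \<pi> \<sigma>" "rep_equivalent G (rep_comp \<sigma> \<phi>) \<tau>" for \<sigma> \<tau>
    using rep_equivalent_trans[OF rep_equivalent_comp[OF that(1)] that(2)] assms(3)
    by (simp add: hom_def)
  then show ?thesis
    using assms(1,2) rep_equivalent_refl unfolding dual_map_def irrep_relation_def by blast
qed

lemma dual_map_funpow_class:
  assumes \<phi>: "\<phi> \<in> hom G G" and irr: "\<And>k. rep_comp \<pi> (\<phi> ^^ k) \<in> irreps G"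
  shows "(dual_map G \<phi> ^^ k) (irrep_relation G `` {\<pi>}) = irrep_relation G `` {rep_comp \<pi> (\<phi> ^^ k)}"
proof (induction k)
  case 0
  show ?case by (simp add: rep_comp_id flip: id_def)
next
  case (Suc k)
  have "rep_comp (rep_comp \<pi> (\<phi> ^^ k)) \<phi> = rep_comp \<pi> (\<phi> ^^ Suc k)"
    by (simp only: rep_comp_rep_comp funpow_Suc_right)
  then show ?case
    using Suc dual_map_class[OF irr[of k] _ \<phi>] irr[of "Suc k"]
    by (simp del: funpow.simps add: funpow.simps(2)[where f = "dual_map G \<phi>"])
qed

lemma irrep_class_eq_iff:
  assumes "\<pi> \<in> irreps G" "\<sigma> \<in> irreps G"
  shows "irrep_relation G `` {\<pi>} = irrep_relation G `` {\<sigma>} \<longleftrightarrow> rep_equivalent G \<pi> \<sigma>"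
  using eq_equiv_class_iff[OF equiv_irrep_relation assms] assms
  by (simp add: irrep_relation_def)

lemma unitary_dual_class:
  assumes "c \<in> unitary_dual G" "\<pi> \<in> c"
  shows "\<pi> \<in> irreps G" and "c = irrep_relation G `` {\<pi>}"
proof -
  obtain \<sigma> where c: "c = irrep_relation G `` {\<sigma>}"
    using assms(1) unfolding unitary_dual_def by (rule quotientE)
  then have r: "(\<sigma>, \<pi>) \<in> irrep_relation G" using assms(2) by simp
  then show "\<pi> \<in> irreps G" by (simp add: irrep_relation_def)
  show "c = irrep_relation G `` {\<pi>}"
    unfolding c by (rule equiv_class_eq[OF equiv_irrep_relation r])
qed

lemma unitary_dual_nonempty: "c \<in> unitary_dual G \<Longrightarrow> \<exists>\<pi>. \<pi> \<in> c"
  using in_quotient_imp_non_empty[OF equiv_irrep_relation] unfolding unitary_dual_def by blast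

text \<open>
  Finite dimension and factoring through a finite group may be witnessed by different representatives
  of \<open>c\<close>. Each of them, composed with \<open>\<phi>\<close>, is a witness for the image of \<open>c\<close>.
\<close>

lemma dual_map_in_dual_part:
  assumes X: "X \<in> {unitary_dual G, unitary_dual_f G, unitary_dual_ff G}"
    and \<phi>: "\<phi> \<in> hom G G" and c: "c \<in> X"
    and irr: "\<And>\<pi>. \<pi> \<in> c \<Longrightarrow> rep_comp \<pi> \<phi> \<in> irreps G"
  shows "dual_map G \<phi> c \<in> X"
proof -
  have cd: "c \<in> unitary_dual G"
    using X c by (auto simp: unitary_dual_f_def unitary_dual_ff_def)
  have cls: "dual_map G \<phi> c = irrep_relation G `` {rep_comp \<pi> \<phi>}" if "\<pi> \<in> c" for \<pi>
    using unitary_dual_class[OF cd that] irr[OF that] \<phi> by (metis dual_map_class)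
  have dual: "dual_map G \<phi> c \<in> unitary_dual G"
    using unitary_dual_nonempty[OF cd] cls irr unfolding unitary_dual_def
    by (metis quotientI)
  have mem: "rep_comp \<pi> \<phi> \<in> dual_map G \<phi> c" if "\<pi> \<in> c" for \<pi>
    using irr[OF that] cls[OF that] rep_equivalent_refl[of G "rep_comp \<pi> \<phi>"]
    by (simp add: irrep_relation_def)
  have fd: "dual_map G \<phi> c \<in> unitary_dual_f G" if cf: "c \<in> unitary_dual_f G"
  proof -
    obtain \<pi> where \<pi>: "\<pi> \<in> c" "finite_dimensional_rep \<pi>"
      using cf unfolding unitary_dual_f_def by blast
    then have "finite_dimensional_rep (rep_comp \<pi> \<phi>)"
      by (simp add: finite_dimensional_rep_def rep_comp_def)
    then show ?thesis using dual mem[OF \<pi>(1)] unfolding unitary_dual_f_def by blast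
  qed
  have ff: "dual_map G \<phi> c \<in> unitary_dual_ff G" if cff: "c \<in> unitary_dual_ff G"
  proof -
    obtain \<pi> where \<pi>: "\<pi> \<in> c" "finite_rep G \<pi>" and "c \<in> unitary_dual_f G"
      using cff unfolding unitary_dual_ff_def by blast
    then show ?thesis
      using fd mem[OF \<pi>(1)] finite_rep_comp[OF \<pi>(2) \<phi>] unfolding unitary_dual_ff_def by blast
  qed
  show ?thesis using X c dual fd ff by blast
qed

text \<open>
  All classes in \<open>P\<close> consist of representations to which \<open>periodic_rep_comp\<close> applies, whatever the
  period; on them \<open>dual_map G \<phi> ^^ k\<close> is \<open>[\<pi>] \<mapsto> [\<pi> \<circ> \<phi>\<^sup>k]\<close>, whose fixed points are the
  f-points of \<open>\<phi>\<^sup>k\<close> by definition.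
\<close>

lemma f_points_eq_fixed_points:
  fixes G :: "('g, 'm) monoid_scheme" and \<phi> :: "'g \<Rightarrow> 'g"
    and X :: "('g, 'g \<Rightarrow> complex) rep set set"
  defines "P \<equiv> \<Union>m\<in>{0<..}. f_points G X (\<phi> ^^ m)"
  assumes G: "group G" and \<phi>: "\<phi> \<in> hom G G"
    and X: "X \<in> {unitary_dual G, unitary_dual_f G, unitary_dual_ff G}"
  shows "dual_map G \<phi> ` P \<subseteq> P"
    and "k > 0 \<Longrightarrow> f_points G X (\<phi> ^^ k) = {c \<in> P. (dual_map G \<phi> ^^ k) c = c}"
proof -
  note \<phi>k = hom_funpow[OF G \<phi>]
  have sub: "c \<in> unitary_dual G" if "c \<in> X" for c
    using X that by (auto simp: unitary_dual_f_def unitary_dual_ff_def)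
  have per: "rep_equivalent G \<pi> (rep_comp \<pi> (\<phi> ^^ m))"
    if c: "c \<in> f_points G X (\<phi> ^^ m)" and \<pi>: "\<pi> \<in> c" for c m \<pi>
  proof -
    obtain \<sigma> where \<sigma>: "c \<in> X" "\<sigma> \<in> c" "rep_equivalent G \<sigma> (rep_comp \<sigma> (\<phi> ^^ m))"
      using c by (auto simp: f_points_def)
    have "rep_equivalent G \<sigma> \<pi>" "unitary_rep G \<sigma>"
      using unitary_dual_class[OF sub \<sigma>(2)] \<pi> \<sigma>(1) by (auto simp: irrep_relation_def irreps_def)
    then show ?thesis using f_point_independent \<phi>k \<sigma>(3) by blast
  qed
  have irr: "rep_comp \<pi> (\<phi> ^^ i) \<in> irreps G" if "c \<in> P" "\<pi> \<in> c" for c \<pi> i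
  proof -
    from that obtain m where m: "m > 0" "c \<in> f_points G X (\<phi> ^^ m)" by (auto simp: P_def)
    then have "\<pi> \<in> irreps G"
      using unitary_dual_class(1)[OF sub that(2)] by (auto simp: f_points_def)
    then show ?thesis using periodic_rep_comp(1)[OF G \<phi> _ m(1)] per[OF m(2) that(2)] by blast
  qed
  have PX: "c \<in> X" if "c \<in> P" for c using that by (auto simp: P_def f_points_def)
  show "dual_map G \<phi> ` P \<subseteq> P"
  proof
    fix e assume "e \<in> dual_map G \<phi> ` P"
    then obtain c where c: "c \<in> P" "e = dual_map G \<phi> c" by blast
    then obtain m where m: "m > 0" "c \<in> f_points G X (\<phi> ^^ m)" by (auto simp: P_def)
    obtain \<pi> where \<pi>: "\<pi> \<in> c" using unitary_dual_nonempty sub PX c(1) by blast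
    have irr1: "rep_comp \<sigma> \<phi> \<in> irreps G" if "\<sigma> \<in> c" for \<sigma>
      using irr[OF c(1) that, of 1] by simp
    have "\<pi> \<in> irreps G" using unitary_dual_class(1)[OF sub \<pi>] PX[OF c(1)] by blast
    then have "rep_equivalent G (rep_comp \<pi> \<phi>) (rep_comp (rep_comp \<pi> \<phi>) (\<phi> ^^ m))"
      using periodic_rep_comp(2)[OF G \<phi> _ m(1) per[OF m(2) \<pi>], of 1] by simp
    moreover have "rep_comp \<pi> \<phi> \<in> e"
      using \<pi> irr1[OF \<pi>] rep_equivalent_refl unfolding c(2) dual_map_def irrep_relation_def by blast
    moreover have "e \<in> X" unfolding c(2) by (rule dual_map_in_dual_part[OF X \<phi> PX[OF c(1)] irr1])
    ultimately have "e \<in> f_points G X (\<phi> ^^ m)" by (auto simp: f_points_def)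
    then show "e \<in> P" using m(1) by (auto simp: P_def)
  qed
  show "f_points G X (\<phi> ^^ k) = {c \<in> P. (dual_map G \<phi> ^^ k) c = c}" if k: "k > 0"
  proof -
    have iff: "(dual_map G \<phi> ^^ k) c = c \<longleftrightarrow> rep_equivalent G \<pi> (rep_comp \<pi> (\<phi> ^^ k))"
      if c: "c \<in> P" and \<pi>: "\<pi> \<in> c" for c \<pi>
    proof -
      have cl: "\<pi> \<in> irreps G" "c = irrep_relation G `` {\<pi>}"
        using unitary_dual_class[OF sub \<pi>] PX[OF c] by blast+
      have "(dual_map G \<phi> ^^ k) c = irrep_relation G `` {rep_comp \<pi> (\<phi> ^^ k)}"
        using dual_map_funpow_class[OF \<phi> irr[OF c \<pi>]] cl(2) by simp
      then show ?thesis using irrep_class_eq_iff[OF cl(1) irr[OF c \<pi>]] cl(2) by metis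
    qed
    show ?thesis
    proof (intro equalityI subsetI)
      fix c assume c: "c \<in> f_points G X (\<phi> ^^ k)"
      then have "c \<in> P" using k by (auto simp: P_def)
      moreover obtain \<pi> where "\<pi> \<in> c" using c by (auto simp: f_points_def)
      ultimately show "c \<in> {c \<in> P. (dual_map G \<phi> ^^ k) c = c}" using iff per[OF c] by blast
    next
      fix c assume c: "c \<in> {c \<in> P. (dual_map G \<phi> ^^ k) c = c}"
      then obtain \<pi> where "\<pi> \<in> c" using unitary_dual_nonempty sub PX by blast
      then show "c \<in> f_points G X (\<phi> ^^ k)" using iff[of c \<pi>] c PX unfolding f_points_def by blast
    qed
  qed
qed

section \<open>The congruences for Reidemeister numbers\<close>

theorem theorem3p3:
  fixes G :: "('g, 'm) monoid_scheme" (structure)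
    and \<phi> :: "'g \<Rightarrow> 'g"
    and X :: "('g, 'g \<Rightarrow> complex) rep set set"
    and n :: nat
  assumes "group G"
    and "\<phi> \<in> hom G G"
    and "X \<in> {unitary_dual G, unitary_dual_f G, unitary_dual_ff G}"
    and "\<forall>k\<ge>1. tbft G X (\<phi> ^^ k)"
    and "n \<ge> 1"
  shows "[(\<Sum>d | d dvd n. moebius_mu d * int (reidemeister_number G (\<phi> ^^ (n div d)))) = 0]
           (mod (int n))"
proof -
  define P where "P = (\<Union>m\<in>{0<..}. f_points G X (\<phi> ^^ m))"
  let ?T = "dual_map G \<phi>"
  note fp = f_points_eq_fixed_points[OF assms(1-3), folded P_def]
  have n: "n > 0" using assms(5) by simp
  have R: "reidemeister_number G (\<phi> ^^ k) = card {c \<in> P. (?T ^^ k) c = c}"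
    and fin: "finite {c \<in> P. (?T ^^ k) c = c}" if "k > 0" for k
  proof -
    have "tbft G X (\<phi> ^^ k)" using assms(4) that by simp
    then show "reidemeister_number G (\<phi> ^^ k) = card {c \<in> P. (?T ^^ k) c = c}"
      and "finite {c \<in> P. (?T ^^ k) c = c}"
      unfolding fp(2)[OF that, symmetric] by (simp_all add: tbft_def)
  qed
  have "n div d > 0" if "d dvd n" for d using that n by (auto elim!: dvdE)
  then have "(\<Sum>d | d dvd n. moebius_mu d * int (reidemeister_number G (\<phi> ^^ (n div d))))
      = (\<Sum>d | d dvd n. moebius_mu d * int (card {c \<in> P. (?T ^^ (n div d)) c = c}))"
    by (intro sum.cong) (simp_all add: R)
  then show ?thesis using moebius_sum_fixed_points[OF fp(1) n fin[OF n]] by simp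
qed

end
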